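(* Let $\alpha>0$, $\delta\in(0,\alpha)$, $\kappa>0$ be real numbers and $m\geq 1$ an integer, and let $A(s)=\sum_{n} a_n\lambda_n^{-s}$ be a general Dirichlet series with non-negative coefficients satisfying Hypothesis B for $\alpha,\delta,\kappa,m$ (with growth constant $C\ge 1$). If $x\geq 2$ then $$\sum_{\lambda_n\leq x} a_n=\operatorname{Res}_{s=\alpha}\Big[A(s)\frac{x^s}{s}\Big]+O_{\alpha,\delta,\kappa,m,C,A(\alpha+\delta)}\Big(x^{\alpha-\frac{\delta}{\kappa+1}}(\log x)^{m-1}\Big),$$ where the implied constant depends only on $\alpha,\delta,\kappa,m,C$ and the value $A(\alpha+\delta)$, and not otherwise on $A(s)$, $(a_n)_n$ or $(\lambda_n)_n$.
   Context: A general Dirichlet series with non-negative coefficients is $A(s)=\sum_{n\ge1}a_n\lambda_n^{-s}$, where $1\leq\lambda_1<\lambda_2<\cdots$ are real numbers tending to infinity and $a_n\geq 0$ are real; it is well-defined for $s$ in an appropriate right half-plane. Hypothesis B (for real $\alpha>0$, $\delta\in(0,\alpha)$, $\kappa\geq 0$ and integer $m\ge1$): The general Dirichlet series $A(s)=\sum_n a_n\lambda_n^{-s}$ with non-negative coefficients can be analytically continued to the region $\Re(s)\geq\alpha-\delta$ aside from a pole of order $m$ at the real point $s=\alpha$. Moreover, for some $M_1,M_2\geq 0$, $$|(s-\alpha)^mA(s)|\leq M_1\exp(|s|^{M_2})\quad\text{for all } s \text{ in the strip } \alpha-\delta\leq\Re(s)\leq\alpha,$$ and there exists $C\geq 1$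 such that for $\Re(s)=\alpha-\delta$, $$|A(s)|\leq C(1+|\Im(s)|)^{\kappa}(\log(3+|\Im(s)|))^{m-1}.$$ *)

theory Defs
  imports "HOL-Complex_Analysis.Complex_Analysis"
begin

text \<open>
  Coefficients and frequencies are indexed from 0, so that \<open>lam 0\<close> is the smallest frequency.
\<close>

definition dirichlet_data :: "(nat \<Rightarrow> real) \<Rightarrow> (nat \<Rightarrow> real) \<Rightarrow> bool" where
  "dirichlet_data a lam \<longleftrightarrow>
     (\<forall>n. a n \<ge> 0) \<and> 1 \<le> lam 0 \<and> strict_mono lam \<and> filterlim lam at_top sequentially"

text \<open>
  The series is only required to converge, with sum \<open>A s\<close>, on some right half-plane. Elsewhere
  \<open>A\<close> is a continuation of it, whose analyticity is imposed separately.
\<close>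

definition has_dirichlet_series ::
    "(complex \<Rightarrow> complex) \<Rightarrow> (nat \<Rightarrow> real) \<Rightarrow> (nat \<Rightarrow> real) \<Rightarrow> bool" where
  "has_dirichlet_series A a lam \<longleftrightarrow>
     (\<exists>\<sigma>. \<forall>s. Re s > \<sigma> \<longrightarrow>
        (\<lambda>n. complex_of_real (a n) * complex_of_real (lam n) powr (- s)) sums A s)"

text \<open>
  The value of \<open>A\<close> at the pole itself is irrelevant. The growth constant \<open>C\<close> is a parameter because
  error terms may depend on it, whereas \<open>M1\<close> and \<open>M2\<close> are existentially quantified because they may not.
\<close>

definition hypothesis_B ::
    "real \<Rightarrow> real \<Rightarrow> real \<Rightarrow> nat \<Rightarrow> real \<Rightarrow>
     (nat \<Rightarrow> real) \<Rightarrow> (nat \<Rightarrow> real) \<Rightarrow> (complex \<Rightarrow> complex) \<Rightarrow> bool" where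
  "hypothesis_B \<alpha> \<delta> \<kappa> m C a lam A \<longleftrightarrow>
     dirichlet_data a lam \<and>
     has_dirichlet_series A a lam \<and>
     A analytic_on ({s. Re s \<ge> \<alpha> - \<delta>} - {complex_of_real \<alpha>}) \<and>
     is_pole A (complex_of_real \<alpha>) \<and>
     zorder A (complex_of_real \<alpha>) = - int m \<and>
     (\<exists>M1 M2. M1 \<ge> 0 \<and> M2 \<ge> 0 \<and>
        (\<forall>s. \<alpha> - \<delta> \<le> Re s \<and> Re s \<le> \<alpha> \<longrightarrow>
           norm ((s - complex_of_real \<alpha>) ^ m * A s) \<le> M1 * exp (norm s powr M2))) \<and>
     (\<forall>s. Re s = \<alpha> - \<delta> \<longrightarrow>
        norm (A s) \<le> C * (1 + \<bar>Im s\<bar>) powr \<kappa> * ln (3 + \<bar>Im s\<bar>) ^ (m - 1))"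

end

theory Submission
  imports Defs "HOL-Real_Asymp.Real_Asymp"
begin

text \<open>
  The counting function is sandwiched between two of its multiplicative averages. Averaging
  \<open>k\<close> times over \<open>[x, x e\<^sup>h]\<close> multiplies the Perron kernel \<open>x\<^sup>s / s\<close> by
  \<open>((e\<^bsup>hs\<^esup> - 1) / (hs))\<^sup>k\<close>, which makes all integrals absolutely convergent; a positive \<open>h\<close> gives
  an upper bound and a negative \<open>h\<close> a lower bound, because the coefficients are nonnegative.
  The contour is moved from \<open>Re s = \<alpha> + \<delta>\<close> to \<open>Re s = \<alpha> - \<delta>\<close>, where the integral is at most
  of order \<open>x\<^bsup>\<alpha> - \<delta>\<^esup> T\<^sup>\<kappa> (log T)\<^bsup>m - 1\<^esup>\<close> with \<open>T = 1 / \<bar>h\<bar>\<close>. Smoothing changes the residue by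
  \<open>O(x\<^sup>\<alpha> (log x)\<^bsup>m - 1\<^esup> / T)\<close>, as seen on a circle of radius proportional to \<open>1 / log x\<close>. The choice
  \<open>T = x\<^bsup>\<delta> / (\<kappa> + 1)\<^esup>\<close> balances the two errors. Uniformity of the constants requires a bound for
  \<open>(s - \<alpha>)\<^sup>m A(s)\<close> in the whole strip, which a Phragmen--Lindelof argument derives from the
  bounds on its two edges.
\<close>

section \<open>Shifting vertical lines of integration\<close>

text \<open>The obstacle is uniformity. Hypothesis B gives constants \<open>M1\<close> and
  \<open>M2\<close> on which the result may not depend, it bounds A nowhere between Re s = \<alpha>
  and Re s = \<alpha> + \<delta>, and it does not place the abscissa of convergence. Landau's
  theorem yields convergence for Re s > \<alpha>, and nonnegative coefficients then give |A(s)|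
  \<le> A(Re s). So the single value A(\<alpha> + \<delta>) controls the whole right-hand line;
  \<open>M1\<close>, \<open>M2\<close> and the size of A near \<alpha> only make the
  Phragmen--Lindelof argument admissible and drop out of its conclusion. The number k of averagings
  has two tasks. Each averaging gains a factor of order 1 / (|h| |s|) at large height. These factors
  must beat the polynomial growth in the strip, so that the horizontal edges vanish. On the left
  line, m - 1 of them absorb the growth of the logarithm above height T, and at least 2 \<kappa>
  others must remain for convergence. This keeps the logarithm at the power m - 1. At the pole the
  same power results because a pole of order m costs (log x)^m on the small circle, whose length
  wins one logarithm back.\<close>

lemma has_bochner_integral_even_FTC:
  fixes f F :: "real \<Rightarrow> real"
  assumes "f \<in> borel_measurable borel"
    and "\<And>t. t \<ge> 0 \<Longrightarrow> DERIV F t :> f t" and "\<And>t. f t \<ge> 0" and even: "\<And>t. f (-t) = f t"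
    and lim: "(F \<longlongrightarrow> L) at_top"
  shows "has_bochner_integral lborel f (2 * (L - F 0))"
proof -
  note [measurable] = assms(1)
  have mono: "F 0 \<le> F t" if "t \<ge> 0" for t
    using assms(2,3) that by (intro DERIV_nonneg_imp_nondecreasing[of 0 t F]) auto
  have FL: "F 0 \<le> L"
    by (rule tendsto_lowerbound[OF lim]) (auto intro!: eventually_mono[OF eventually_ge_at_top[of 0]] mono)
  have pos: "(\<integral>\<^sup>+t. ennreal (f t) * indicator {0..} t \<partial>lborel) = ennreal (L - F 0)"
    using assms by (intro nn_integral_FTC_atLeast) auto
  have neg: "(\<integral>\<^sup>+t. ennreal (f t) * indicator {..0} t \<partial>lborel) = ennreal (L - F 0)"
  proof -
    have "(\<integral>\<^sup>+t. ennreal (f t) * indicator {..0} t \<partial>lborel) =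
          (\<integral>\<^sup>+t. ennreal (f (-t)) * indicator {..0} (-t) \<partial>lborel)"
      by (subst nn_integral_real_affine[where c = "-1" and t = 0]) auto
    also have "\<dots> = (\<integral>\<^sup>+t. ennreal (f t) * indicator {0..} t \<partial>lborel)"
      by (intro nn_integral_cong) (auto simp: even indicator_def)
    finally show ?thesis using pos by simp
  qed
  have "(\<integral>\<^sup>+t. ennreal (f t) \<partial>lborel) =
        (\<integral>\<^sup>+t. ennreal (f t) * indicator {0..} t + ennreal (f t) * indicator {..0} t \<partial>lborel)"
    by (intro nn_integral_cong_AE AE_I[of _ _ "{0}"]) (auto simp: indicator_def)
  also have "\<dots> = ennreal (2 * (L - F 0))"
    using FL by (subst nn_integral_add) (auto simp: pos neg simp flip: ennreal_plus)
  finally show ?thesis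
    using assms(3) FL by (intro has_bochner_integral_nn_integral) auto
qed

lemma has_bochner_integral_inverse_square_plus:
  assumes "c > 0"
  shows "has_bochner_integral lborel (\<lambda>t::real. 1 / (c\<^sup>2 + t\<^sup>2)) (pi / c)"
proof -
  have "has_bochner_integral lborel (\<lambda>t::real. 1 / (c\<^sup>2 + t\<^sup>2)) (2 * (pi / (2 * c) - arctan (0 / c) / c))"
  proof (rule has_bochner_integral_even_FTC)
    show "((\<lambda>t. arctan (t / c) / c) \<longlongrightarrow> pi / (2 * c)) at_top"
      using assms by (real_asymp simp: field_simps)
    show "((\<lambda>t. arctan (t / c) / c) has_real_derivative 1 / (c\<^sup>2 + t\<^sup>2)) (at t)" for t
      using assms by (auto intro!: derivative_eq_intros simp: power_divide divide_simps power2_eq_square)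
  qed auto
  thus ?thesis using assms by simp
qed

lemma continuous_on_vertical_line:
  assumes "continuous_on {s. Re s = c} f"
  shows "continuous_on A (\<lambda>t. f (Complex c t))"
proof -
  have "continuous_on A (f \<circ> Complex c)"
    by (rule continuous_on_compose) 
       (auto intro!: continuous_intros continuous_on_subset[OF assms] simp: Complex_eq)
  thus ?thesis by (simp add: o_def)
qed

lemma integral_symmetric_tendsto:
  fixes f :: "real \<Rightarrow> complex"
  assumes "integrable lborel f"
  shows "((\<lambda>T. integral {-T..T} f) \<longlongrightarrow> (LINT t|lborel. f t)) at_top"
proof -
  have eq: "integral {-T..T} f = (LINT t|lborel. indicator {-T..T} t *\<^sub>R f t)" for T :: real
  proof -
    have "set_integrable lborel {-T..T} f"
      using assms by (auto simp: set_integrable_def intro!: integrable_mult_indicator)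
    from set_borel_integral_eq_integral(2)[OF this] show ?thesis
      by (simp add: set_lebesgue_integral_def)
  qed
  show ?thesis unfolding eq
  proof (rule tendsto_at_topI_sequentially)
    fix X :: "nat \<Rightarrow> real" assume X: "filterlim X at_top sequentially"
    show "(\<lambda>n. LINT t|lborel. indicator {-X n..X n} t *\<^sub>R f t) \<longlonglongrightarrow> (LINT t|lborel. f t)"
    proof (rule integral_dominated_convergence[where w = "\<lambda>t. norm (f t)"])
      show "AE t in lborel. (\<lambda>n. indicator {-X n..X n} t *\<^sub>R f t) \<longlonglongrightarrow> f t"
      proof
        fix t
        have "eventually (\<lambda>n. \<bar>t\<bar> \<le> X n) sequentially"
          using X unfolding filterlim_at_top by blast
        thus "(\<lambda>n. indicator {-X n..X n} t *\<^sub>R f t) \<longlonglongrightarrow> f t"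
          by (intro tendsto_eventually; elim eventually_mono) (auto simp: indicator_def)
      qed
    qed (use assms in \<open>auto split: split_indicator\<close>)
  qed
qed

text \<open>\<open>S\<close> is merely open, whereas the residue theorem wants a connected region
  outside which the winding number vanishes. By compactness a slightly larger open box
  \<open>U\<close> still lies in \<open>S\<close>, and it has both properties.\<close>

lemma contour_integral_rectpath_residue:
  assumes "open S" "f holomorphic_on S - {p}" "cbox a b \<subseteq> S" "p \<in> box a b"
  shows "contour_integral (rectpath a b) f = 2 * pi * \<i> * residue f p"
proof -
  have lt: "Re a \<le> Re b" "Im a \<le> Im b" using assms(4) by (auto simp: in_box_complex_iff)
  have pi: "path_image (rectpath a b) = cbox a b - box a b"
    using lt by (simp add: path_image_rectpath_cbox_minus_box)
  obtain e where e: "e > 0" "\<And>x. x \<in> cbox a b \<Longrightarrow> ball x e \<subseteq> S"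
  proof -
    have "compact (cbox a b)" by simp
    then obtain e where "e > 0" "(\<Union>x\<in>cbox a b. ball x e) \<subseteq> S"
      by (rule compact_subset_open_imp_ball_epsilon_subset[OF _ assms(1,3)])
    thus ?thesis by (intro that[of e]) auto
  qed
  define U where "U = box (a - Complex (e/2) (e/2)) (b + Complex (e/2) (e/2))"
  have "U \<subseteq> S"
  proof
    fix z assume z: "z \<in> U"
    \<comment> \<open>The point of the rectangle nearest to \<open>z\<close>, found by clamping both
      coordinates; each moves by less than e/2.\<close>
    define w where "w = Complex (max (Re a) (min (Re b) (Re z))) (max (Im a) (min (Im b) (Im z)))"
    have "w \<in> cbox a b" using lt by (auto simp: w_def in_cbox_complex_iff)
    moreover have "norm (w - z) < e"
    proof -
      have "norm (w - z) \<le> \<bar>Re (w - z)\<bar> + \<bar>Im (w - z)\<bar>" by (rule cmod_le)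
      also have "\<bar>Re (w - z)\<bar> < e / 2"
        using z e(1) lt by (auto simp: U_def in_box_complex_iff w_def max_def min_def)
      also have "\<bar>Im (w - z)\<bar> < e / 2"
        using z e(1) lt by (auto simp: U_def in_box_complex_iff w_def max_def min_def)
      finally show ?thesis by simp
    qed
    ultimately show "z \<in> S" using e(2)[of w] by (auto simp: dist_norm)
  qed
  have sub: "cbox a b \<subseteq> U" using e(1) by (auto simp: U_def in_box_complex_iff in_cbox_complex_iff)
  have *: "contour_integral (rectpath a b) f =
        2 * pi * \<i> * (\<Sum>p\<in>{p}. winding_number (rectpath a b) p * residue f p)"
  proof (rule Residue_theorem)
    show "open U" "connected U" by (auto simp: U_def intro: convex_connected)
    show "f holomorphic_on U - {p}" using \<open>U \<subseteq> S\<close> by (intro holomorphic_on_subset[OF assms(2)]) auto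
    show "path_image (rectpath a b) \<subseteq> U - {p}" using assms(4) sub by (auto simp: pi)
    show "\<forall>z. z \<notin> U \<longrightarrow> winding_number (rectpath a b) z = 0"
      using sub lt by (auto intro!: winding_number_rectpath_outside)
  qed auto
  show ?thesis
    using winding_number_rectpath[OF assms(4)] by (simp add: *)
qed

text \<open>Absolute convergence makes both line integrals limits of symmetric truncations, so only
  the horizontal edges at height \<plusminus>T are in the way, and they contribute at most 2 (b - a)
  g(T). Integration is with respect to the ordinate t, hence 2 pi without the imaginary
  unit.\<close>

lemma vertical_line_shift:
  fixes f :: "complex \<Rightarrow> complex" and g :: "real \<Rightarrow> real"
  assumes "open S" "f holomorphic_on S - {p}" "{s. a \<le> Re s \<and> Re s \<le> b} \<subseteq> S"
    and p: "a < Re p" "Re p < b"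
    and int: "integrable lborel (\<lambda>t. f (Complex a t))" "integrable lborel (\<lambda>t. f (Complex b t))"
    and bound: "\<And>s. a \<le> Re s \<Longrightarrow> Re s \<le> b \<Longrightarrow> \<bar>Im s\<bar> > T0 \<Longrightarrow> norm (f s) \<le> g \<bar>Im s\<bar>"
    and g: "(g \<longlongrightarrow> 0) at_top"
  shows "(LINT t|lborel. f (Complex b t)) - (LINT t|lborel. f (Complex a t)) = 2 * pi * residue f p"
proof -
  have ab: "a < b" using p by simp
  have ev: "eventually (\<lambda>T. T > 0 \<and> T > \<bar>Im p\<bar> \<and> T > T0) at_top"
    by (intro eventually_conj eventually_gt_at_top)
  have bd: "norm ((integral {-T..T} (\<lambda>t. f (Complex b t)) - integral {-T..T} (\<lambda>t. f (Complex a t)))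
                - 2 * pi * residue f p) \<le> 2 * (b - a) * g T"
    if T: "T > 0" "T > \<bar>Im p\<bar>" "T > T0" for T
  proof -
    have g0: "g T \<ge> 0"
      using order_trans[OF norm_ge_zero bound[of "Complex a T"]] T ab by simp
    let ?a = "Complex a (-T)" and ?b = "Complex b T"
    let ?c = "Complex b (-T)" and ?d = "Complex a T"
    have sub: "cbox ?a ?b \<subseteq> S" using assms(3) by (auto simp: in_cbox_complex_iff)
    have inb: "p \<in> box ?a ?b" using p T by (auto simp: in_box_complex_iff)
    have c1: "contour_integral (rectpath ?a ?b) f = 2 * pi * \<i> * residue f p"
      by (rule contour_integral_rectpath_residue[OF assms(1,2) sub inb])
    have seg: "closed_segment u v \<subseteq> S - {p}" if "closed_segment u v \<subseteq> path_image (rectpath ?a ?b)" for u v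
      using that inb sub ab T
      by (subst (asm) path_image_rectpath_cbox_minus_box) auto
    have cont: "continuous_on (S - {p}) f"
      using assms(2) holomorphic_on_imp_continuous_on by blast
    have pieq: "path_image (rectpath ?a ?b) = closed_segment ?a ?c \<union> closed_segment ?c ?b \<union>
        closed_segment ?b ?d \<union> closed_segment ?d ?a"
      by (simp add: rectpath_def path_image_join Let_def Un_assoc)
    have ci: "f contour_integrable_on linepath u v" if "closed_segment u v \<subseteq> path_image (rectpath ?a ?b)" for u v
      using continuous_on_subset[OF cont seg[OF that]] by (rule contour_integrable_continuous_linepath)
    have ci': "f contour_integrable_on linepath ?a ?c" "f contour_integrable_on linepath ?c ?b"
        "f contour_integrable_on linepath ?b ?d" "f contour_integrable_on linepath ?d ?a"
      by (rule ci; auto simp: pieq)+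
    have c2: "contour_integral (rectpath ?a ?b) f =
        contour_integral (linepath ?a ?c) f + contour_integral (linepath ?c ?b) f +
        contour_integral (linepath ?b ?d) f + contour_integral (linepath ?d ?a) f"
      using ci' by (simp add: rectpath_def Let_def contour_integral_join contour_integrable_join algebra_simps)
    have v1: "contour_integral (linepath ?c ?b) f = \<i> * integral {-T..T} (\<lambda>t. f (Complex b t))"
      by (rule contour_integral_linepath_same_Re) (use T in auto)
    have v2: "contour_integral (linepath ?d ?a) f = - (\<i> * integral {-T..T} (\<lambda>t. f (Complex a t)))"
    proof -
      have "contour_integral (linepath ?a ?d) f = \<i> * integral {-T..T} (\<lambda>t. f (Complex a t))"
        by (rule contour_integral_linepath_same_Re) (use T in auto)
      thus ?thesis using contour_integral_reverse_linepath[of ?d ?a f]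
        continuous_on_subset[OF cont seg[of ?d ?a]] by (simp add: pieq)
    qed
    have bound2: "norm (f s) \<le> g T" if "a \<le> Re s" "Re s \<le> b" "\<bar>Im s\<bar> = T" for s
      using bound[of s] that T by simp
    have h1: "norm (contour_integral (linepath ?a ?c) f) \<le> g T * norm (?c - ?a)"
      by (rule contour_integral_bound_linepath[OF ci'(1) g0])
         (use bound2 T ab in \<open>auto simp: closed_segment_same_Im closed_segment_eq_real_ivl\<close>)
    have h2: "norm (contour_integral (linepath ?b ?d) f) \<le> g T * norm (?d - ?b)"
      by (rule contour_integral_bound_linepath[OF ci'(3) g0])
         (use bound2 T ab in \<open>auto simp: closed_segment_same_Im closed_segment_eq_real_ivl\<close>)
    have n: "norm (?c - ?a) = b - a" "norm (?d - ?b) = b - a" 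
      using ab by (auto simp: cmod_def)
    have "\<i> * ((integral {-T..T} (\<lambda>t. f (Complex b t)) - integral {-T..T} (\<lambda>t. f (Complex a t)))
                - 2 * pi * residue f p) =
        - (contour_integral (linepath ?a ?c) f + contour_integral (linepath ?b ?d) f)"
      using c1 c2 v1 v2 by (simp add: algebra_simps)
    hence "norm (\<i> * ((integral {-T..T} (\<lambda>t. f (Complex b t)) - integral {-T..T} (\<lambda>t. f (Complex a t)))
                - 2 * pi * residue f p)) \<le> g T * (b - a) + g T * (b - a)"
      using h1 h2 n by (simp only: norm_minus_cancel) (rule norm_triangle_le, simp)
    thus ?thesis unfolding norm_mult by (simp add: algebra_simps)
  qed
  have lim: "((\<lambda>T. (integral {-T..T} (\<lambda>t. f (Complex b t)) - integral {-T..T} (\<lambda>t. f (Complex a t)))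
                - 2 * pi * residue f p) \<longlongrightarrow>
      ((LINT t|lborel. f (Complex b t)) - (LINT t|lborel. f (Complex a t))) - 2 * pi * residue f p) at_top"
    by (intro tendsto_intros integral_symmetric_tendsto int)
  have "((\<lambda>T. (integral {-T..T} (\<lambda>t. f (Complex b t)) - integral {-T..T} (\<lambda>t. f (Complex a t)))
                - 2 * pi * residue f p) \<longlongrightarrow> 0) at_top"
  proof (rule Lim_null_comparison)
    show "((\<lambda>T. 2 * (b - a) * g T) \<longlongrightarrow> 0) at_top"
      using tendsto_mult[OF tendsto_const g, of "2 * (b - a)"] by simp
  qed (use ev bd in \<open>auto elim: eventually_mono\<close>)
  from tendsto_unique[OF _ lim this] show ?thesis by simp
qed

section \<open>Perron integrals with a smoothed kernel\<close>

text \<open>The case \<open>d = -c\<close> serves the Perron integral, whose contour is also moved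
  to the left of the origin.\<close>

lemma vertical_line_integral_decay:
  fixes f :: "complex \<Rightarrow> complex"
  assumes "c > 0" "d = c \<or> d = -c" "continuous_on {s. Re s = d} f"
    and "\<And>t. norm (f (Complex d t)) \<le> B / (c\<^sup>2 + t\<^sup>2)"
  shows "integrable lborel (\<lambda>t. f (Complex d t))"
    and "norm (LINT t|lborel. f (Complex d t)) \<le> B * (pi / c)"
proof -
  have *: "has_bochner_integral lborel (\<lambda>t. B * (1 / (c\<^sup>2 + t\<^sup>2))) (B * (pi / c))"
    by (intro has_bochner_integral_mult_right has_bochner_integral_inverse_square_plus assms)
  show int: "integrable lborel (\<lambda>t. f (Complex d t))"
  proof (rule Bochner_Integration.integrable_bound)
    show "integrable lborel (\<lambda>t. B * (1 / (c\<^sup>2 + t\<^sup>2)))"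
      using * by (rule integrable.intros)
    show "(\<lambda>t. f (Complex d t)) \<in> borel_measurable lborel"
      using continuous_on_vertical_line[OF assms(3), of UNIV]
      by (simp add: borel_measurable_continuous_onI)
  qed (use assms(4) in \<open>auto intro!: AE_I2 order_trans[OF assms(4)] divide_right_mono\<close>)
  have "norm (LINT t|lborel. f (Complex d t)) \<le> (LINT t|lborel. B * (1 / (c\<^sup>2 + t\<^sup>2)))"
    by (rule Bochner_Integration.integral_norm_bound_integral[OF int integrable.intros[OF *]])
       (use assms(4) in auto)
  also have "\<dots> = B * (pi / c)"
    using * by (rule has_bochner_integral_integral_eq)
  finally show "norm (LINT t|lborel. f (Complex d t)) \<le> B * (pi / c)" .
qed

text \<open>The truncated power whose Laplace transform is 1 / s^(k+1). At k = 0 the convention 0 ^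
  0 = 1 makes it constantly 1 instead of a step, so the facts below take k \<ge> 1.\<close>

definition tpow :: "nat \<Rightarrow> real \<Rightarrow> real" where
  "tpow k t = max t 0 ^ k / fact k"

lemma norm_power_Suc_ge:
  assumes "k \<ge> 1" "r > 0" "norm (s::complex) \<ge> r"
  shows "norm (s ^ (k + 1)) \<ge> r ^ (k - 1) * ((Re s)\<^sup>2 + (Im s)\<^sup>2)"
proof -
  have "norm (s ^ (k + 1)) = norm s ^ (k - 1) * norm s ^ 2"
    using assms(1) by (simp only: norm_power flip: power_add) simp
  also have "\<dots> = norm s ^ (k - 1) * ((Re s)\<^sup>2 + (Im s)\<^sup>2)"
    by (simp add: cmod_def)
  also have "\<dots> \<ge> r ^ (k - 1) * ((Re s)\<^sup>2 + (Im s)\<^sup>2)"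
    using assms by (intro mult_right_mono power_mono) auto
  finally show ?thesis .
qed

lemma norm_exp_over_power_le:
  assumes "k \<ge> 1" "r > 0" "norm (s::complex) \<ge> r" "u * Re s \<le> B"
  shows "norm (exp (of_real u * s) / s ^ (k + 1)) \<le> exp B / r ^ (k - 1) / ((Re s)\<^sup>2 + (Im s)\<^sup>2)"
proof -
  have nz: "s \<noteq> 0" using assms by auto
  hence pos: "(Re s)\<^sup>2 + (Im s)\<^sup>2 > 0"
    by (auto simp: complex_eq_iff sum_power2_gt_zero_iff)
  have "norm (exp (of_real u * s) / s ^ (k + 1)) = exp (u * Re s) / norm (s ^ (k + 1))"
    by (simp add: norm_divide)
  also have "\<dots> \<le> exp B / (r ^ (k - 1) * ((Re s)\<^sup>2 + (Im s)\<^sup>2))"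
    using norm_power_Suc_ge[OF assms(1-3)] assms pos by (intro frac_le) auto
  finally show ?thesis by simp
qed

lemma higher_deriv_exp_linear:
  "(deriv ^^ n) (\<lambda>s. exp (c * s)) = (\<lambda>s. (c::complex) ^ n * exp (c * s))"
proof (induction n)
  case (Suc n)
  have "deriv (\<lambda>s. c ^ n * exp (c * s)) s = c ^ Suc n * exp (c * s)" for s
    by (rule DERIV_imp_deriv) (auto intro!: derivative_eq_intros)
  thus ?case using Suc by auto
qed auto

text \<open>For u \<le> 0 the contour escapes to the right without meeting a pole. For u > 0 it
  escapes to the left across 0, where the residue is the Taylor coefficient u^k / k!. Either way the
  integral over the line at distance R is at most pi / R.\<close>

lemma perron_power:
  assumes "c > 0" "k \<ge> 1"
  shows "integrable lborel (\<lambda>t. exp (of_real u * Complex c t) / Complex c t ^ (k + 1))" (is ?I)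
    and "(LINT t|lborel. exp (of_real u * Complex c t) / Complex c t ^ (k + 1)) = 2 * pi * tpow k u" (is ?E)
proof -
  define f where "f = (\<lambda>s::complex. exp (of_real u * s) / s ^ (k + 1))"
  have cont: "continuous_on {s. Re s = d} f" if "d \<noteq> 0" for d
    using that unfolding f_def by (intro continuous_intros) auto
  have holo: "f holomorphic_on A - {0}" for A
    unfolding f_def by (auto intro!: holomorphic_intros)
  have line: "integrable lborel (\<lambda>t. f (Complex d t)) \<and>
      norm (LINT t|lborel. f (Complex d t)) \<le> exp B / r ^ (k - 1) * (pi / r)"
    if "r > 0" "d = r \<or> d = -r" "u * d \<le> B" for r d B
    using vertical_line_integral_decay[OF that(1,2) cont, of "exp B / r ^ (k - 1)"]
      norm_exp_over_power_le[OF assms(2) that(1), of "Complex d t" u B for t] that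
      abs_Re_le_cmod[of "Complex d t" for t] unfolding f_def by force
  from line[of c c "u * c"] assms show ?I by (auto simp: f_def)
  have int_c: "integrable lborel (\<lambda>t. f (Complex c t))" using line[of c c "u * c"] assms by auto
  have hor: "norm (f s) \<le> exp B / \<bar>Im s\<bar> ^ 2"
    if "u * Re s \<le> B" "\<bar>Im s\<bar> > 1" for s B
  proof -
    have "norm (f s) \<le> exp B / 1 ^ (k - 1) / ((Re s)\<^sup>2 + (Im s)\<^sup>2)"
      using that abs_Im_le_cmod[of s] unfolding f_def by (intro norm_exp_over_power_le assms) auto
    also have "\<dots> \<le> exp B / \<bar>Im s\<bar> ^ 2"
      using that by (simp, intro frac_le) (auto simp: zero_less_power2)
    finally show ?thesis .
  qed
  have glim: "((\<lambda>t. exp B / t ^ 2) \<longlongrightarrow> 0) at_top" for B :: real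
    by real_asymp
  have main: "norm ((LINT t|lborel. f (Complex c t)) - 2 * pi * tpow k u) \<le> pi / R" if R: "R > max c 1" for R
  proof (cases "u \<le> 0")
    case True
    have *: "u * d \<le> 0" if "d \<ge> c" for d using True that assms by (intro mult_nonpos_nonneg) auto
    \<comment> \<open>No pole lies between the two lines. The midpoint (c + R) / 2 merely fills the
      slot for the singularity in \<open>vertical_line_shift\<close>, and its residue is 0.\<close>
    have 1: "(LINT t|lborel. f (Complex R t)) - (LINT t|lborel. f (Complex c t)) =
             2 * pi * residue f (of_real ((c + R) / 2))"
    proof (rule vertical_line_shift)
      show "open {s. Re s > 0}" by (rule open_halfspace_Re_gt)
      show "f holomorphic_on {s. Re s > 0} - {of_real ((c + R) / 2)}"
        using holo[of "{s. Re s > 0}"] by (rule holomorphic_on_subset) auto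
      show "norm (f s) \<le> exp 0 / \<bar>Im s\<bar> ^ 2" if "c \<le> Re s" "\<bar>Im s\<bar> > 1" for s
        using *[OF that(1)] that by (intro hor) auto
    qed (use glim[of 0] int_c line[of R R "u * R"] assms R in auto)
    have "residue f (of_real ((c + R) / 2)) = 0"
      using holo[of "{s. Re s > 0}"] assms R
      by (intro residue_holo[of "{s. Re s > 0}"]) (auto simp: open_halfspace_Re_gt)
    with 1 have "(LINT t|lborel. f (Complex R t)) = (LINT t|lborel. f (Complex c t))" by simp
    moreover have "norm (LINT t|lborel. f (Complex R t)) \<le> exp 0 / R ^ (k - 1) * (pi / R)"
      using line[of R R 0] R *[of R] assms by auto
    moreover have "exp 0 / R ^ (k - 1) * (pi / R) \<le> 1 * (pi / R)"
      using R by (intro mult_right_mono) (auto simp: divide_simps)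
    moreover have "tpow k u = 0" using True assms by (simp add: tpow_def max_def)
    ultimately show ?thesis by simp
  next
    case False
    have 1: "(LINT t|lborel. f (Complex c t)) - (LINT t|lborel. f (Complex (-R) t)) =
             2 * pi * residue f 0"
    proof (rule vertical_line_shift)
      show "f holomorphic_on UNIV - {0}" by (rule holo)
      show "norm (f s) \<le> exp (u * c) / \<bar>Im s\<bar> ^ 2" if "Re s \<le> c" "\<bar>Im s\<bar> > 1" for s
        using that False by (intro hor) (auto intro: mult_left_mono)
    qed (use glim[of "u * c"] int_c line[of R "-R" "u * (-R)"] assms R in auto)
    have "residue f 0 = (deriv ^^ k) (\<lambda>s. exp (of_real u * s)) 0 / fact k"
      unfolding f_def using residue_holomorphic_over_power'[of UNIV "\<lambda>s. exp (of_real u * s)" k]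
      by (auto intro!: holomorphic_intros)
    also have "\<dots> = tpow k u"
      using False by (simp add: higher_deriv_exp_linear tpow_def)
    finally have "residue f 0 = tpow k u" .
    hence 2: "(LINT t|lborel. f (Complex c t)) - 2 * pi * tpow k u = (LINT t|lborel. f (Complex (-R) t))" 
      using 1 by (simp add: algebra_simps)
    have "norm (LINT t|lborel. f (Complex (-R) t)) \<le> exp 0 / R ^ (k - 1) * (pi / R)"
      using line[of R "-R" 0] R assms False by auto
    also have "exp 0 / R ^ (k - 1) * (pi / R) \<le> 1 * (pi / R)"
      using R by (intro mult_right_mono) (auto simp: divide_simps)
    finally show ?thesis by (simp only: 2 mult_1)
  qed
  have "norm ((LINT t|lborel. f (Complex c t)) - 2 * pi * tpow k u) \<le> 0"
  proof (rule tendsto_lowerbound)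
    show "((\<lambda>R::real. pi / R) \<longlongrightarrow> 0) at_top" by real_asymp
    show "eventually (\<lambda>R. norm ((LINT t|lborel. f (Complex c t)) - 2 * pi * tpow k u) \<le> pi / R) at_top"
      using eventually_gt_at_top[of "max c 1"] main by (auto elim!: eventually_mono)
  qed auto
  thus ?E by (simp add: f_def)
qed

section \<open>Iterated differences and k-fold averages of the unit step\<close>

primrec fdiff :: "nat \<Rightarrow> real \<Rightarrow> (real \<Rightarrow> real) \<Rightarrow> real \<Rightarrow> real" where
  "fdiff 0 h f t = f t"
| "fdiff (Suc k) h f t = fdiff k h f (t + h) - fdiff k h f t"

lemma DERIV_fdiff:
  assumes "\<And>t. DERIV F t :> f t"
  shows "DERIV (fdiff k h F) t :> fdiff k h f t"
proof (induction k arbitrary: t)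
  case 0
  have "fdiff 0 h F = F" by (simp add: fun_eq_iff)
  thus ?case using assms by simp
next
  case (Suc k)
  have "DERIV (\<lambda>t. fdiff k h F (t + h) - fdiff k h F t) t :> fdiff k h f (t + h) - fdiff k h f t"
    using Suc[of "t + h"] Suc[of t] by (intro DERIV_diff) (simp_all flip: DERIV_shift add: add.commute)
  thus ?case by simp
qed

lemma DERIV_tpow:
  assumes "k \<ge> 1"
  shows "DERIV (tpow (Suc k)) t :> tpow k t"
proof -
  have f: "fact (Suc k) = (1 + real k) * (fact k :: real)" by simp
  have pos: "DERIV (\<lambda>t::real. t ^ Suc k / fact (Suc k)) t :> t ^ k / fact k" for t
  proof -
    have "DERIV (\<lambda>t::real. t ^ Suc k / fact (Suc k)) t :> (1 + real k) * t ^ k / fact (Suc k)"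
      using DERIV_power_Suc[of "\<lambda>t. t" 1 t UNIV k] by (intro DERIV_cdivide) simp
    thus ?thesis unfolding f by simp
  qed
  consider "t > 0" | "t < 0" | "t = 0" by linarith
  thus ?thesis
  proof cases
    case 1
    have "DERIV (tpow (Suc k)) t :> t ^ k / fact k"
      by (rule DERIV_cong_ev[THEN iffD2, OF refl _ refl pos])
         (use eventually_nhds_in_open[of "{0<..}" t] 1 in \<open>auto elim!: eventually_mono simp: tpow_def\<close>)
    thus ?thesis using 1 by (simp add: tpow_def)
  next
    case 2
    have "DERIV (tpow (Suc k)) t :> 0"
      by (rule DERIV_cong_ev[THEN iffD2, OF refl _ refl DERIV_const[of 0]])
         (use eventually_nhds_in_open[of "{..<0}" t] 2 in \<open>auto elim!: eventually_mono simp: tpow_def\<close>)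
    thus ?thesis using 2 assms by (simp add: tpow_def power_0_left)
  next
    case 3
    have "((\<lambda>y. tpow (Suc k) y / y) \<longlongrightarrow> 0) (at 0)"
    proof (rule Lim_null_comparison)
      show "\<forall>\<^sub>F y in at 0. norm (tpow (Suc k) y / y) \<le> \<bar>y\<bar> ^ k"
      proof (rule always_eventually, rule allI)
        fix y :: real
        have "max y 0 ^ Suc k \<le> \<bar>y\<bar> ^ Suc k" by (intro power_mono) auto
        moreover have "(1::real) \<le> fact (Suc k)" by (rule fact_ge_1)
        ultimately have "max y 0 ^ Suc k / fact (Suc k) \<le> \<bar>y\<bar> ^ Suc k / 1"
          by (intro frac_le) auto
        hence "tpow (Suc k) y / \<bar>y\<bar> \<le> \<bar>y\<bar> ^ Suc k / \<bar>y\<bar>"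
          unfolding tpow_def by (intro divide_right_mono) auto
        moreover have "tpow (Suc k) y \<ge> 0" by (simp add: tpow_def)
        ultimately show "norm (tpow (Suc k) y / y) \<le> \<bar>y\<bar> ^ k"
          by (cases "y = 0") (auto simp: abs_divide)
      qed
      show "((\<lambda>y::real. \<bar>y\<bar> ^ k) \<longlongrightarrow> 0) (at 0)"
        using assms by (auto intro!: tendsto_eq_intros)
    qed
    thus ?thesis using 3 assms by (simp add: has_field_derivative_iff tpow_def power_0_left)
  qed
qed

text \<open>Divided by \<open>h ^ k\<close> this is the k-fold average of the unit step over windows
  of length h, which explains the values 1, 0 and the transition zone between them. The induction
  avoids integrals: \<open>fdiff k h (tpow (Suc k))\<close> has derivative
  \<open>fdiff k h (tpow k)\<close>, so by the mean value theorem its increment over [t, t + h] is h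
  times a value of the latter inside that interval.\<close>

lemma fdiff_tpow:
  assumes "h > 0" "k \<ge> 1"
  shows "fdiff k h (tpow k) t \<ge> 0 \<and> fdiff k h (tpow k) t \<le> h ^ k \<and>
         (t \<ge> 0 \<longrightarrow> fdiff k h (tpow k) t = h ^ k) \<and>
         (t \<le> - (k * h) \<longrightarrow> fdiff k h (tpow k) t = 0)"
  using assms(2)
proof (induction k arbitrary: t rule: dec_induct)
  case base
  thus ?case using assms(1) by (auto simp: tpow_def)
next
  case (step k)
  have "\<exists>z. t < z \<and> z < t + h \<and> 
      fdiff k h (tpow (Suc k)) (t + h) - fdiff k h (tpow (Suc k)) t = (t + h - t) * fdiff k h (tpow k) z"
    using assms step by (intro MVT2 DERIV_fdiff DERIV_tpow) auto
  then obtain z where z: "t < z" "z < t + h" "fdiff (Suc k) h (tpow (Suc k)) t = h * fdiff k h (tpow k) z"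
    by auto
  have "t \<le> - (Suc k * h) \<Longrightarrow> z \<le> - (k * h)"
    using z by (simp add: algebra_simps)
  thus ?case using step.IH[of z] z assms by (auto intro: mult_left_mono)
qed

text \<open>Each difference multiplies the integrand by exp (h s) - 1. The number j of differences
  is kept apart from the exponent k + 1, so that every stage of the induction has an absolutely
  convergent integral.\<close>

lemma perron_fdiff:
  fixes h :: real
  assumes "c > 0" "k \<ge> 1"
  defines "f \<equiv> (\<lambda>j u s. exp (of_real u * s) * (exp (of_real h * s) - 1) ^ j / s ^ (k + 1))"
  shows "integrable lborel (\<lambda>t. f j u (Complex c t)) \<and>
         (LINT t|lborel. f j u (Complex c t)) = 2 * pi * fdiff j h (tpow k) u"
proof (induction j arbitrary: u)
  case 0
  thus ?case using perron_power[OF assms(1,2), of u] by (simp add: f_def)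
next
  case (Suc j)
  have eq: "f (Suc j) u s = f j (u + h) s - f j u s" for s
    by (simp add: f_def exp_add field_simps diff_divide_distrib ring_distribs)
  show ?case using Suc unfolding eq
    by (auto simp: algebra_simps of_real_diff)
qed

text \<open>The mean of exp (v s) for v between 0 and h, with h of either sign. Its limit at s = 0
  is 1, but division by zero assigns 0 there, so the estimates below keep s away from 0.\<close>

definition boxker :: "real \<Rightarrow> complex \<Rightarrow> complex" where
  "boxker h s = (exp (of_real h * s) - 1) / (of_real h * s)"

text \<open>With u = ln (x / \<lambda>), w is the weight of a term of frequency \<lambda> in the
  smoothed count. The last two claims produce the sandwich: for h > 0 no term with \<lambda> \<le> x
  loses weight, and for h < 0 no term with \<lambda> > x receives any.\<close>

lemma smoothed_perron:
  fixes h u :: real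
  assumes "c > 0" "k \<ge> 1" "h \<noteq> 0"
  defines "f \<equiv> (\<lambda>t. exp (of_real u * Complex c t) / Complex c t * boxker h (Complex c t) ^ k)"
  obtains w :: real where "integrable lborel f" "(LINT t|lborel. f t) = 2 * pi * w" "0 \<le> w" "w \<le> 1"
    "h > 0 \<Longrightarrow> u \<ge> 0 \<Longrightarrow> w = 1" "h < 0 \<Longrightarrow> u \<le> 0 \<Longrightarrow> w = 0"
proof -
  \<comment> \<open>Since \<open>boxker (-h) s = exp (- (h * s)) * boxker h s\<close>, a negative
    step is a positive one with u moved back by k |h|.\<close>
  define h' u' :: real where "h' = \<bar>h\<bar>" and "u' = (if h > 0 then u else u - k * h')"
  have h': "h' > 0" using assms by (auto simp: h'_def)
  define g where "g = (\<lambda>t. exp (of_real u' * Complex c t) * (exp (of_real h' * Complex c t) - 1) ^ k / Complex c t ^ (k + 1))"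
  have nz: "Complex c t \<noteq> 0" for t using assms by (auto simp: complex_eq_iff)
  have eq: "f t = g t / h' ^ k" for t
  proof (cases "h > 0")
    case True
    thus ?thesis using nz[of t]
      by (simp add: f_def g_def boxker_def u'_def h'_def power_divide power_mult_distrib field_simps)
  next
    case False
    define s where "s = Complex c t"
    have s: "s \<noteq> 0" using nz s_def by auto
    have 1: "boxker h s = exp (- (of_real h' * s)) * (exp (of_real h' * s) - 1) / (of_real h' * s)"
      using False assms(3) s by (simp add: boxker_def h'_def ring_distribs exp_minus field_simps)
    have 2: "exp (of_real u' * s) = exp (of_real u * s) * exp (- (of_real h' * s)) ^ k"
      using False by (simp add: u'_def ring_distribs exp_diff exp_minus field_simps flip: exp_of_nat_mult)
    show ?thesis using s h'
      unfolding f_def g_def 1 2 s_def[symmetric]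
      by (simp add: power_divide power_mult_distrib) (simp add: exp_minus power_inverse field_simps)
  qed
  have g: "integrable lborel g" "(LINT t|lborel. g t) = 2 * pi * fdiff k h' (tpow k) u'"
    using perron_fdiff[OF assms(1,2), where h = h' and j = k and u = u'] by (auto simp: g_def)
  define w where "w = fdiff k h' (tpow k) u' / h' ^ k"
  show ?thesis
  proof (rule that[of w])
    show "integrable lborel f" using g unfolding eq by auto
    show "(LINT t|lborel. f t) = 2 * pi * w" using g unfolding eq w_def by simp
    show "0 \<le> w" "w \<le> 1" using fdiff_tpow[OF h' assms(2), of u'] h' by (auto simp: w_def)
    show "w = 1" if "h > 0" "u \<ge> 0"
      using fdiff_tpow[OF h' assms(2), of u'] h' that by (auto simp: w_def u'_def)
    show "w = 0" if "h < 0" "u \<le> 0"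
      using fdiff_tpow[OF h' assms(2), of u'] h' that by (auto simp: w_def u'_def)
  qed
qed

section \<open>Landau's theorem\<close>

lemma dirichlet_term_eq:
  assumes "lam > 0"
  shows "complex_of_real a * complex_of_real lam powr (-s) = of_real a * exp (- of_real (ln lam) * s)"
  using assms by (simp add: powr_def Ln_of_real mult.commute)

lemma norm_dirichlet_term:
  assumes "lam > 0" "a \<ge> 0"
  shows "norm (complex_of_real a * complex_of_real lam powr (-s)) = a * lam powr (- Re s)"
  using assms by (simp add: norm_mult norm_powr_real_powr)

lemma dirichlet_term_of_real:
  assumes "lam > 0"
  shows "complex_of_real a * complex_of_real lam powr (- of_real x) = of_real (a * lam powr (-x))"
proof -
  have "complex_of_real lam powr of_real (-x) = of_real (lam powr (-x))"
    using assms by (intro powr_of_real) auto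
  thus ?thesis by simp
qed

lemma dirichlet_dataD:
  assumes "dirichlet_data a lam"
  shows "a n \<ge> 0" "lam n \<ge> 1" "lam n > 0"
proof -
  show "a n \<ge> 0" using assms by (auto simp: dirichlet_data_def)
  have "lam 0 \<le> lam n"
    using assms by (auto simp: dirichlet_data_def strict_mono_less_eq)
  thus "lam n \<ge> 1" using assms by (auto simp: dirichlet_data_def)
  thus "lam n > 0" by simp
qed

lemma dirichlet_uniform_limit:
  assumes "dirichlet_data a lam" "summable (\<lambda>n. a n * lam n powr (-x))"
  shows "uniform_limit {s. Re s \<ge> x} (\<lambda>N s. \<Sum>n<N. of_real (a n) * of_real (lam n) powr (-s))
           (\<lambda>s. \<Sum>n. complex_of_real (a n) * of_real (lam n) powr (-s)) sequentially"
proof (rule Weierstrass_m_test[OF _ assms(2)])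
  fix n and s :: complex assume s: "s \<in> {s. Re s \<ge> x}"
  note [simp] = dirichlet_dataD[OF assms(1)]
  have "a n * lam n powr (- Re s) \<le> a n * lam n powr (-x)"
    using s by (intro mult_left_mono powr_mono) auto
  thus "norm (complex_of_real (a n) * of_real (lam n) powr (-s)) \<le> a n * lam n powr (-x)"
    by (simp add: norm_dirichlet_term)
qed

lemma dirichlet_partial_holomorphic:
  assumes "dirichlet_data a lam"
  shows "(\<lambda>s. \<Sum>n<N. complex_of_real (a n) * of_real (lam n) powr (-s)) holomorphic_on S"
  unfolding dirichlet_term_eq[OF dirichlet_dataD(3)[OF assms]] by (intro holomorphic_intros)

lemma higher_deriv_exp_sum:
  "(deriv ^^ k) (\<lambda>s. \<Sum>n<N. b n * exp (- c n * s)) =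
   (\<lambda>s. \<Sum>n<N. b n * (- c n) ^ k * exp (- c n * s :: complex))"
proof (induction k)
  case (Suc k)
  have "deriv (\<lambda>s. \<Sum>n<N. b n * (- c n) ^ k * exp (- c n * s)) s =
        (\<Sum>n<N. b n * (- c n) ^ Suc k * exp (- c n * s))" for s
    by (rule DERIV_imp_deriv) (auto intro!: derivative_eq_intros sum.cong simp: algebra_simps)
  thus ?case using Suc by auto
qed auto

text \<open>
  Landau: at a real point \<open>s0\<close> of convergence, the Taylor coefficients of the sum alternate in sign,
  so the Taylor expansion at a real point to the left of \<open>s0\<close> can be rearranged by monotonicity alone.
\<close>

theorem dirichlet_landau_summable:
  assumes dat: "dirichlet_data a lam" and ser: "has_dirichlet_series A a lam"
    and holo: "A holomorphic_on {s. Re s > \<alpha>}" and x: "x > \<alpha>"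
  shows "summable (\<lambda>n. a n * lam n powr (-x))"
proof -
  note dd [simp] = dirichlet_dataD[OF dat]
  obtain \<sigma> where \<sigma>: "\<And>s. Re s > \<sigma> \<Longrightarrow> (\<lambda>n. complex_of_real (a n) * of_real (lam n) powr (-s)) sums A s"
    using ser by (auto simp: has_dirichlet_series_def)
  have summ: "summable (\<lambda>n. a n * lam n powr (-y))" if "y > \<sigma>" for y
  proof -
    have "summable (\<lambda>n. complex_of_real (a n) * of_real (lam n) powr (- of_real y))"
      using \<sigma>[of "of_real y"] that by (auto dest: sums_summable)
    thus ?thesis by (simp only: dirichlet_term_of_real dd summable_of_real_iff)
  qed
  show ?thesis
  proof (cases "x > \<sigma>")
    case False
    \<comment> \<open>Two units leave \<open>s0\<close> inside the open half-plane Re s > \<sigma> +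
      1, on which the series converges uniformly and may be differentiated termwise.\<close>
    define s0 where "s0 = \<sigma> + 2"
    define L where "L = (\<lambda>n. ln (lam n))"
    have L: "L n \<ge> 0" for n by (simp add: L_def)
    define P where "P = (\<lambda>N k. \<Sum>n<N. a n * L n ^ k * exp (- L n * s0))"
    have P_mono: "P N k \<le> P N' k" if "N \<le> N'" for N N' k
      unfolding P_def using L that by (intro sum_mono2) auto
    have lim: "(\<lambda>N. complex_of_real (P N k)) \<longlonglongrightarrow> (-1) ^ k * (deriv ^^ k) A (of_real s0)" for k
    proof -
      have "(\<lambda>N. (deriv ^^ k) (\<lambda>s. \<Sum>n<N. complex_of_real (a n) * of_real (lam n) powr (-s)) (of_real s0))
              \<longlonglongrightarrow> (deriv ^^ k) A (of_real s0)"
      proof (rule higher_deriv_complex_uniform_limit)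
        have "uniform_limit {s. Re s \<ge> \<sigma> + 1} (\<lambda>N s. \<Sum>n<N. of_real (a n) * of_real (lam n) powr (-s))
           (\<lambda>s. \<Sum>n. complex_of_real (a n) * of_real (lam n) powr (-s)) sequentially"
          by (intro dirichlet_uniform_limit dat summ) auto
        hence "uniform_limit {s. Re s > \<sigma> + 1} (\<lambda>N s. \<Sum>n<N. of_real (a n) * of_real (lam n) powr (-s))
           (\<lambda>s. \<Sum>n. complex_of_real (a n) * of_real (lam n) powr (-s)) sequentially"
          by (rule uniform_limit_on_subset) auto
        thus "uniform_limit {s. Re s > \<sigma> + 1} (\<lambda>N s. \<Sum>n<N. of_real (a n) * of_real (lam n) powr (-s)) A sequentially"
          by (rule uniform_limit_cong'[THEN iffD1, rotated 2]) (auto intro: sums_unique[OF \<sigma>, symmetric])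
      qed (auto intro!: always_eventually dirichlet_partial_holomorphic dat simp: open_halfspace_Re_gt s0_def)
      moreover have "(deriv ^^ k) (\<lambda>s. \<Sum>n<N. complex_of_real (a n) * of_real (lam n) powr (-s)) (of_real s0)
          = of_real ((-1) ^ k * P N k)" for N
      proof -
        have "(deriv ^^ k) (\<lambda>s. \<Sum>n<N. complex_of_real (a n) * of_real (lam n) powr (-s)) (of_real s0) =
              (\<Sum>n<N. of_real (a n) * (- of_real (L n)) ^ k * exp (- of_real (L n) * of_real s0))"
          unfolding dirichlet_term_eq[OF dd(3)] L_def
          by (rule fun_cong[OF higher_deriv_exp_sum])
        also have "\<dots> = of_real (\<Sum>n<N. a n * (- L n) ^ k * exp (- L n * s0))"
          by (simp flip: exp_of_real)
        also have "(\<Sum>n<N. a n * (- L n) ^ k * exp (- L n * s0)) = (-1) ^ k * P N k"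
          unfolding P_def sum_distrib_left by (intro sum.cong) (auto simp: power_minus[of "L _"])
        finally show ?thesis .
      qed
      ultimately have "(\<lambda>N. (-1) ^ k * complex_of_real ((-1) ^ k * P N k)) \<longlonglongrightarrow> (-1) ^ k * (deriv ^^ k) A (of_real s0)"
        by (intro tendsto_mult tendsto_const) simp
      thus ?thesis by (simp flip: power_mult_distrib mult.assoc)
    qed
    \<comment> \<open>The sums \<open>P N k\<close> increase with N to this limit, so it bounds all
      of them.\<close>
    define c where "c = (\<lambda>k. Re ((-1) ^ k * (deriv ^^ k) A (of_real s0)))"
    have P_le: "P N k \<le> c k" for N k
    proof (rule incseq_le[where X = "\<lambda>N. P N k"])
      show "incseq (\<lambda>N. P N k)" using P_mono by (auto simp: incseq_def)
      show "(\<lambda>N. P N k) \<longlonglongrightarrow> c k" using tendsto_Re[OF lim[of k]] by (simp add: c_def)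
    qed
    define y where "y = s0 - x"
    have y: "y > 0" using False by (simp add: y_def s0_def)
    have "(\<lambda>k. (deriv ^^ k) A (of_real s0) / fact k * (of_real x - of_real s0) ^ k) sums A (of_real x)"
    proof (rule holomorphic_power_series)
      show "A holomorphic_on ball (of_real s0) (s0 - \<alpha>)"
      proof (rule holomorphic_on_subset[OF holo], safe)
        fix s assume "s \<in> ball (complex_of_real s0) (s0 - \<alpha>)"
        thus "Re s > \<alpha>"
          using abs_Re_le_cmod[of "of_real s0 - s"] by (simp add: dist_norm)
      qed
      show "of_real x \<in> ball (complex_of_real s0) (s0 - \<alpha>)"
        using y x unfolding y_def by (simp add: dist_norm norm_of_real flip: of_real_diff)
    qed
    moreover have "(deriv ^^ k) A (of_real s0) / fact k * (of_real x - of_real s0) ^ k = 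
         (-1) ^ k * (deriv ^^ k) A (of_real s0) * of_real (y ^ k / fact k)" for k
    proof -
      have "complex_of_real x - of_real s0 = - of_real y" by (simp add: y_def)
      thus ?thesis using power_minus[of "complex_of_real y" k] by simp
    qed
    ultimately have "(\<lambda>k. (-1) ^ k * (deriv ^^ k) A (of_real s0) * of_real (y ^ k / fact k)) sums A (of_real x)"
      by (simp only:)
    from sums_Re[OF this] have taylor: "(\<lambda>k. c k * (y ^ k / fact k)) sums Re (A (of_real x))"
      by (simp only: c_def flip: Re_complex_of_real) (simp only: times_complex.sel Re_complex_of_real Im_complex_of_real mult_zero_right diff_zero)
    \<comment> \<open>Expanding each exp (y L_n) writes the partial sum at x as the series of
      \<open>P N k * (y ^ k / fact k)\<close>, dominated term by term by the Taylor series of A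
      about \<open>s0\<close>. That series reaches x because A is holomorphic for Re s > \<alpha>,
      and its sum is a bound free of N.\<close>
    have "(\<Sum>n<N. a n * lam n powr (-x)) \<le> Re (A (of_real x))" for N
    proof (rule sums_le[OF _ _ taylor])
      have "(\<lambda>k. \<Sum>n<N. a n * exp (- L n * s0) * ((y * L n) ^ k /\<^sub>R fact k)) sums
              (\<Sum>n<N. a n * exp (- L n * s0) * exp (y * L n))"
        by (intro sums_sum sums_mult exp_converges)
      also have "(\<Sum>n<N. a n * exp (- L n * s0) * exp (y * L n)) = (\<Sum>n<N. a n * lam n powr (-x))"
      proof (rule sum.cong)
        fix n
        have "lam n \<noteq> 0" using dd(3)[of n] by linarith
        thus "a n * exp (- L n * s0) * exp (y * L n) = a n * lam n powr (-x)"
          by (simp add: powr_def L_def y_def algebra_simps flip: exp_add)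
      qed auto
      also have "(\<lambda>k. \<Sum>n<N. a n * exp (- L n * s0) * ((y * L n) ^ k /\<^sub>R fact k)) = (\<lambda>k. P N k * (y ^ k / fact k))"
        unfolding P_def sum_distrib_right
        by (intro ext sum.cong refl) (simp add: power_mult_distrib field_simps)
      finally show "(\<lambda>k. P N k * (y ^ k / fact k)) sums (\<Sum>n<N. a n * lam n powr (-x))" .
      show "P N k * (y ^ k / fact k) \<le> c k * (y ^ k / fact k)" for k
        using P_le y by (intro mult_right_mono) auto
    qed
    thus ?thesis by (intro summableI_nonneg_bounded) auto
  qed (use summ in auto)
qed

text \<open>Summability does not yet identify the sum. As a locally uniform limit the sum
  \<open>D\<close> is holomorphic, it agrees with A far to the right, and the identity theorem
  extends the agreement.\<close>

theorem dirichlet_landau_sums: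
  assumes dat: "dirichlet_data a lam" and ser: "has_dirichlet_series A a lam"
    and holo: "A holomorphic_on {s. Re s > \<alpha>}" and s: "Re s > \<alpha>"
  shows "(\<lambda>n. complex_of_real (a n) * complex_of_real (lam n) powr (-s)) sums A s"
proof -
  note dd [simp] = dirichlet_dataD[OF dat]
  obtain \<sigma> where \<sigma>: "\<And>s. Re s > \<sigma> \<Longrightarrow> (\<lambda>n. complex_of_real (a n) * of_real (lam n) powr (-s)) sums A s"
    using ser by (auto simp: has_dirichlet_series_def)
  define D where "D = (\<lambda>s. \<Sum>n. complex_of_real (a n) * of_real (lam n) powr (-s))"
  have "D holomorphic_on {s. Re s > \<alpha>}"
  proof (rule holomorphic_uniform_sequence)
    show "(\<lambda>s. \<Sum>n<N. complex_of_real (a n) * of_real (lam n) powr (-s)) holomorphic_on {s. Re s > \<alpha>}" for N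
      by (rule dirichlet_partial_holomorphic[OF dat])
    fix z assume z: "z \<in> {s. Re s > \<alpha>}"
    define d where "d = (Re z - \<alpha>) / 2"
    have sub: "cball z d \<subseteq> {s. Re s \<ge> \<alpha> + d}"
    proof
      fix s assume "s \<in> cball z d"
      thus "s \<in> {s. Re s \<ge> \<alpha> + d}"
        using abs_Re_le_cmod[of "z - s"] by (simp add: dist_norm d_def field_simps)
    qed
    have d: "d > 0" using z by (simp add: d_def)
    show "\<exists>d>0. cball z d \<subseteq> {s. Re s > \<alpha>} \<and>
       uniform_limit (cball z d) (\<lambda>N s. \<Sum>n<N. complex_of_real (a n) * of_real (lam n) powr (-s)) D sequentially"
      unfolding D_def using sub d
      by (intro exI[of _ d] conjI uniform_limit_on_subset[OF dirichlet_uniform_limit[OF dat] sub]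
                dirichlet_landau_summable[OF dat ser holo])
         auto
  qed (auto simp: open_halfspace_Re_gt)
  have "D s = A s"
  proof (rule analytic_continuation_open[of "{s. Re s > max \<alpha> \<sigma>}" "{s. Re s > \<alpha>}" D A s])
    have "of_real (max \<alpha> \<sigma> + 1) \<in> {s. Re s > max \<alpha> \<sigma>}"
      unfolding mem_Collect_eq Re_complex_of_real by linarith
    thus "{s. Re s > max \<alpha> \<sigma>} \<noteq> {}" by blast
    show "connected {s. Re s > \<alpha>}" by (intro convex_connected convex_halfspace_Re_gt)
    show "D z = A z" if "z \<in> {s. Re s > max \<alpha> \<sigma>}" for z
      using that sums_unique[OF \<sigma>[of z]] by (simp add: D_def)
  qed (use holo s \<open>D holomorphic_on _\<close> in \<open>auto simp: open_halfspace_Re_gt simp del: max_less_iff_conj\<close>)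
  moreover have "summable (\<lambda>n. complex_of_real (a n) * complex_of_real (lam n) powr (-s))"
    by (rule summable_norm_cancel)
       (use dirichlet_landau_summable[OF dat ser holo s] in \<open>simp add: norm_dirichlet_term\<close>)
  ultimately show ?thesis by (auto simp: D_def sums_iff)
qed

section \<open>Polynomial growth in a strip\<close>

lemma double_exp_decay:
  fixes a c d M :: real
  assumes "c > 0" "d > 0" "M \<ge> 0"
  shows "((\<lambda>T. exp ((a + T) powr M) * exp (- c * exp (T / d))) \<longlongrightarrow> 0) at_top"
proof (cases "M = 0")
  case True
  have "((\<lambda>T::real. exp ((a + T) powr 0) * exp (- c * exp (T / d))) \<longlongrightarrow> 0) at_top"
    using assms by real_asymp
  thus ?thesis using True by simp
next
  case False
  hence "M > 0" using assms by simp
  hence "((\<lambda>T. exp ((a + T) powr M - c * exp (T / d))) \<longlongrightarrow> 0) at_top"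
    using assms by real_asymp
  thus ?thesis by (simp add: exp_diff exp_minus field_simps)
qed

text \<open>Re cos (x + iy) = cos x cosh y. Dividing by \<delta> keeps |x| \<le> 1, where cos x
  \<ge> cos 1 > 0, and cosh y \<ge> exp |y| / 2. The decay is doubly exponential in the height and
  so beats exp (|s|^M2) for every exponent \<open>M2\<close>.\<close>

lemma strip_damping_factor:
  fixes \<alpha> \<delta> \<epsilon> :: real
  assumes "\<delta> > 0" "\<epsilon> > 0" "\<bar>Re z - \<alpha>\<bar> \<le> \<delta>"
  shows "norm (exp (- of_real \<epsilon> * cos ((z - of_real \<alpha>) / of_real \<delta>))) \<le> exp (- (\<epsilon> * cos 1 / 2) * exp (\<bar>Im z\<bar> / \<delta>))"
proof -
  have c1: "cos 1 > (0::real)" using pi_gt3 by (intro cos_gt_zero_pi) auto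
  have "\<bar>(Re z - \<alpha>) / \<delta>\<bar> \<le> 1" using assms by (simp add: abs_divide)
  hence "cos 1 \<le> cos \<bar>(Re z - \<alpha>) / \<delta>\<bar>"
    using pi_gt3 by (intro cos_monotone_0_pi_le) auto
  hence c: "cos ((Re z - \<alpha>) / \<delta>) \<ge> cos 1" by (simp only: cos_abs_real)
  have "exp (\<bar>Im z\<bar> / \<delta>) \<le> exp (Im z / \<delta>) + exp (- (Im z / \<delta>))"
    by (cases "Im z \<ge> 0") (auto simp: add_increasing add_increasing2)
  hence "cos 1 * exp (\<bar>Im z\<bar> / \<delta>) \<le> cos ((Re z - \<alpha>) / \<delta>) * (exp (Im z / \<delta>) + exp (- (Im z / \<delta>)))"
    using c c1 by (intro mult_mono) auto
  hence "\<epsilon> * (cos 1 * exp (\<bar>Im z\<bar> / \<delta>) / 2) \<le> \<epsilon> * (cos ((Re z - \<alpha>) / \<delta>) * (exp (Im z / \<delta>) + exp (- (Im z / \<delta>))) / 2)"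
    using assms by (intro mult_left_mono divide_right_mono) auto
  also have "\<dots> = \<epsilon> * Re (cos ((z - of_real \<alpha>) / of_real \<delta>))"
    by (simp add: Re_cos)
  finally show ?thesis by (simp add: mult_ac)
qed

text \<open>
  A Phragmen--Lindelof principle for a strip. The factor \<open>((z - \<alpha>)\<^sup>2 + T\<^sup>2) ^ m\<close> vanishes
  at \<open>\<alpha> \<plusminus> iT\<close> and thereby compensates the lack of a growth bound that is uniform
  up to the line \<open>Re s = \<alpha>\<close> from the right.
\<close>

lemma strip_polynomial_bound:
  fixes \<alpha> \<delta> D M1 M2 B :: real and F :: "complex \<Rightarrow> complex"
  assumes \<delta>: "0 < \<delta>" "\<delta> < \<alpha>" and D: "D > 0" and M: "M1 \<ge> 0" "M2 \<ge> 0"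
    and holo: "F holomorphic_on S" "{s. \<alpha> - \<delta> \<le> Re s \<and> Re s \<le> \<alpha> + \<delta>} \<subseteq> S"
    and left: "\<And>s. Re s = \<alpha> - \<delta> \<Longrightarrow> norm (F s) \<le> D * norm s ^ N"
    and right: "\<And>s. Re s = \<alpha> + \<delta> \<Longrightarrow> norm (F s) \<le> D * norm s ^ N"
    and growth: "\<And>s. \<alpha> - \<delta> \<le> Re s \<Longrightarrow> Re s \<le> \<alpha> \<Longrightarrow> norm (F s) \<le> M1 * exp (norm s powr M2)"
    and inner: "\<And>s. \<alpha> < Re s \<Longrightarrow> Re s \<le> \<alpha> + \<delta> \<Longrightarrow>
      norm (F s) * (Re s - \<alpha>) ^ m \<le> B * norm (s - of_real \<alpha>) ^ m"
    and s: "\<alpha> - \<delta> \<le> Re s" "Re s \<le> \<alpha> + \<delta>"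
  shows "norm (F s) \<le> 6 ^ m * D * norm s ^ N"
proof -
  \<comment> \<open>Dividing by \<open>z ^ N\<close> turns both edge bounds into the constant D; the
    strip avoids 0 because \<alpha> - \<delta> > 0.\<close>
  define G where "G = (\<lambda>z. F z / z ^ N)"
  define E where "E = (\<lambda>\<epsilon> z. exp (- of_real \<epsilon> * cos ((z - of_real \<alpha>) / of_real \<delta>)) :: complex)"
  have strip_ge: "norm z \<ge> \<alpha> - \<delta>" "z \<noteq> 0" if "Re z \<ge> \<alpha> - \<delta>" for z
    using complex_Re_le_cmod[of z] that \<delta> by auto
  have c1: "cos 1 > (0::real)" using pi_gt3 by (intro cos_gt_zero_pi) auto
  have B: "B \<ge> 0" using inner[of "of_real (\<alpha> + \<delta>)"] \<delta> 
    by (simp add: norm_of_real) (smt (verit) mult_neg_pos mult_nonneg_nonneg norm_ge_zero zero_less_power zero_le_power)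
  have E1: "norm (E \<epsilon> z) \<le> 1" if "\<epsilon> > 0" "\<alpha> - \<delta> \<le> Re z" "Re z \<le> \<alpha> + \<delta>" for \<epsilon> z
  proof -
    have "norm (E \<epsilon> z) \<le> exp (- (\<epsilon> * cos 1 / 2) * exp (\<bar>Im z\<bar> / \<delta>))"
      unfolding E_def using that \<delta> by (intro strip_damping_factor) auto
    also have "\<dots> \<le> exp 0" using that c1 by (subst exp_le_cancel_iff) (auto simp: mult_nonneg_nonneg)
    finally show ?thesis by simp
  qed
  have main: "norm (G s) * norm (E \<epsilon> s) \<le> 6 ^ m * D" if \<epsilon>: "\<epsilon> > 0" for \<epsilon>
  proof -
    define e where "e = (\<lambda>T. exp (- (\<epsilon> * cos 1 / 2) * exp (T / \<delta>)))"
    have lim1: "((\<lambda>T. M1 / (\<alpha> - \<delta>) ^ N * (exp ((\<alpha> + \<delta> + T) powr M2) * e T)) \<longlongrightarrow> M1 / (\<alpha> - \<delta>) ^ N * 0) at_top"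
      unfolding e_def using \<epsilon> c1 \<delta> M by (intro tendsto_mult tendsto_const double_exp_decay) auto
    \<comment> \<open>With exponent 0 the factor \<open>exp ((0 + T) powr 0)\<close> is bounded and
      at least 1, so the same decay lemma also handles \<open>e T\<close> alone.\<close>
    have lim2: "((\<lambda>T. B * 2 ^ m / (\<alpha> - \<delta>) ^ N * (exp ((0 + T) powr 0) * e T)) \<longlongrightarrow> B * 2 ^ m / (\<alpha> - \<delta>) ^ N * 0) at_top"
      unfolding e_def using \<epsilon> c1 \<delta> by (intro tendsto_mult tendsto_const double_exp_decay) auto
    have "eventually (\<lambda>T. M1 / (\<alpha> - \<delta>) ^ N * (exp ((\<alpha> + \<delta> + T) powr M2) * e T) < D) at_top"
         "eventually (\<lambda>T. B * 2 ^ m / (\<alpha> - \<delta>) ^ N * (exp ((0 + T) powr 0) * e T) < D) at_top"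
      using order_tendstoD(2)[OF lim1, of D] order_tendstoD(2)[OF lim2, of D] D by auto
    moreover have "eventually (\<lambda>T. T \<ge> 1 \<and> T \<ge> \<delta> \<and> T \<ge> \<bar>Im s\<bar> \<and> T \<ge> 2 * norm (s - of_real \<alpha>)) at_top"
      by (intro eventually_conj eventually_ge_at_top)
    ultimately have "eventually (\<lambda>T. M1 / (\<alpha> - \<delta>) ^ N * (exp ((\<alpha> + \<delta> + T) powr M2) * e T) < D \<and>
        B * 2 ^ m / (\<alpha> - \<delta>) ^ N * (exp ((0 + T) powr 0) * e T) < D \<and>
        T \<ge> 1 \<and> T \<ge> \<delta> \<and> T \<ge> \<bar>Im s\<bar> \<and> T \<ge> 2 * norm (s - of_real \<alpha>)) at_top"
      by eventually_elim auto
    then obtain T where T1: "M1 / (\<alpha> - \<delta>) ^ N * (exp ((\<alpha> + \<delta> + T) powr M2) * e T) < D"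
      and T2': "B * 2 ^ m / (\<alpha> - \<delta>) ^ N * (exp ((0 + T) powr 0) * e T) < D"
      and T: "T \<ge> 1" "T \<ge> \<delta>" "T \<ge> \<bar>Im s\<bar>" "T \<ge> 2 * norm (s - of_real \<alpha>)"
      unfolding eventually_at_top_linorder by blast
    have T2: "B * 2 ^ m / (\<alpha> - \<delta>) ^ N * e T < D"
    proof -
      have "B * 2 ^ m / (\<alpha> - \<delta>) ^ N * (1 * e T) \<le> B * 2 ^ m / (\<alpha> - \<delta>) ^ N * (exp ((0 + T) powr 0) * e T)"
        using B \<delta> by (intro mult_left_mono mult_right_mono) (auto simp: e_def)
      thus ?thesis using T2' by linarith
    qed
    have e0: "e T > 0" by (simp add: e_def)
    \<comment> \<open>Normalised by T^2, so that |K| \<le> 3 on the rectangle, as T \<ge> \<delta>,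
      and |K(s)| \<ge> 1/2, as T \<ge> 2 |s - \<alpha>|. The ratio of these bounds is the origin of
      \<open>6 ^ m\<close>.\<close>
    define K where "K = (\<lambda>z. ((z - of_real \<alpha>)\<^sup>2 + of_real T ^ 2) / of_real T ^ 2 :: complex)"
    define H where "H = (\<lambda>z. G z * E \<epsilon> z * K z ^ m)"
    have T0: "T > 0" using T by simp
    define Q where "Q = cbox (Complex (\<alpha> - \<delta>) (-T)) (Complex (\<alpha> + \<delta>) T)"
    have Q: "z \<in> Q \<longleftrightarrow> \<alpha> - \<delta> \<le> Re z \<and> Re z \<le> \<alpha> + \<delta> \<and> \<bar>Im z\<bar> \<le> T" for z
      by (auto simp: Q_def in_cbox_complex_iff)
    have QS: "Q \<subseteq> S" using Q holo(2) by auto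
    have holoH: "H holomorphic_on Q"
      unfolding H_def G_def E_def K_def using T0 strip_ge(2) Q \<delta>
      by (intro holomorphic_intros holomorphic_on_subset[OF holo(1) QS]) auto
    have K_le: "norm (K z) \<le> 3" if "z \<in> Q" for z
    proof -
      have "norm (z - of_real \<alpha>) ^ 2 = (Re z - \<alpha>)\<^sup>2 + (Im z)\<^sup>2" by (simp add: cmod_def)
      also have "(Re z - \<alpha>)\<^sup>2 \<le> T\<^sup>2" using that T by (subst abs_le_square_iff[symmetric]) (auto simp: Q)
      also have "(Im z)\<^sup>2 \<le> T\<^sup>2" using that T by (subst abs_le_square_iff[symmetric]) (auto simp: Q)
      finally have "norm (z - of_real \<alpha>) ^ 2 \<le> 2 * T ^ 2" by simp
      hence "norm ((z - of_real \<alpha>)\<^sup>2 + of_real T ^ 2) \<le> 3 * T ^ 2"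
        using norm_triangle_ineq[of "(z - of_real \<alpha>)\<^sup>2" "of_real T ^ 2"] by (simp add: norm_power)
      thus ?thesis using T0 by (simp add: K_def norm_divide norm_power divide_le_eq)
    qed
    have "norm (H s) \<le> 3 ^ m * D"
    proof (rule maximum_modulus_frontier[of H Q])
      show "H holomorphic_on interior Q"
        using holoH interior_subset by (rule holomorphic_on_subset)
      show "continuous_on (closure Q) H"
        using holomorphic_on_imp_continuous_on[OF holoH] by (simp add: Q_def)
      show "bounded Q" by (simp add: Q_def bounded_cbox)
      show "s \<in> Q" using s T by (simp add: Q)
      fix z assume "z \<in> frontier Q"
      hence z: "z \<in> Q" "Re z = \<alpha> - \<delta> \<or> Re z = \<alpha> + \<delta> \<or> \<bar>Im z\<bar> = T"
        by (auto simp: Q_def frontier_cbox in_cbox_complex_iff in_box_complex_iff)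
      have z0: "norm z ^ N > 0" "norm z ^ N \<ge> (\<alpha> - \<delta>) ^ N"
        using strip_ge[of z] z \<delta> by (auto simp: Q intro!: power_mono)
      have Km: "norm (K z) ^ m \<le> 3 ^ m" using K_le[OF z(1)] by (intro power_mono) auto
      consider "Re z = \<alpha> - \<delta> \<or> Re z = \<alpha> + \<delta>" | "\<bar>Im z\<bar> = T" "Re z \<le> \<alpha>" | "\<bar>Im z\<bar> = T" "Re z > \<alpha>"
        using z(2) by linarith
      thus "norm (H z) \<le> 3 ^ m * D"
      proof cases
        case 1
        hence "norm (F z) \<le> D * norm z ^ N" using left right by auto
        hence "norm (G z) \<le> D" using z0 by (simp add: G_def norm_divide norm_power divide_le_eq)
        hence "norm (G z) * norm (E \<epsilon> z) * norm (K z) ^ m \<le> D * 1 * 3 ^ m"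
          using E1[OF \<epsilon>, of z] z(1) Km D by (intro mult_mono) (auto simp: Q)
        thus ?thesis by (simp add: H_def norm_mult norm_power mult.commute)
      next
        case 2
        have "norm z \<le> \<bar>Re z\<bar> + \<bar>Im z\<bar>" by (rule cmod_le)
        also have "\<dots> \<le> \<alpha> + \<delta> + T" using 2 z(1) \<delta> by (auto simp: Q)
        finally have "norm z powr M2 \<le> (\<alpha> + \<delta> + T) powr M2" using M by (intro powr_mono2) auto
        hence "M1 * exp (norm z powr M2) \<le> M1 * exp ((\<alpha> + \<delta> + T) powr M2)"
          using M by (intro mult_left_mono) auto
        with growth[of z] have "norm (F z) \<le> M1 * exp ((\<alpha> + \<delta> + T) powr M2)"
          using 2 z(1) by (auto simp: Q)
        hence "norm (G z) \<le> M1 * exp ((\<alpha> + \<delta> + T) powr M2) / (\<alpha> - \<delta>) ^ N"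
          using z0 \<delta> M unfolding G_def norm_divide norm_power by (intro frac_le) auto
        moreover have "norm (E \<epsilon> z) \<le> e T"
          unfolding E_def e_def using 2 \<delta> \<epsilon> z(1) strip_damping_factor[of \<delta> \<epsilon> z \<alpha>] by (auto simp: Q)
        ultimately have "norm (G z) * norm (E \<epsilon> z) * norm (K z) ^ m \<le>
            (M1 * exp ((\<alpha> + \<delta> + T) powr M2) / (\<alpha> - \<delta>) ^ N) * e T * 3 ^ m"
          using Km M e0 \<delta> by (intro mult_mono) auto
        also have "\<dots> = (M1 / (\<alpha> - \<delta>) ^ N * (exp ((\<alpha> + \<delta> + T) powr M2) * e T)) * 3 ^ m"
          by simp
        also have "\<dots> \<le> D * 3 ^ m" using T1 by (intro mult_right_mono) auto
        finally show ?thesis by (simp add: H_def norm_mult norm_power mult.commute)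
      next
        case 3
        define w where "w = z - of_real \<alpha>"
        have w2: "norm w \<le> 2 * T"
          using cmod_le[of w] 3 z(1) T by (auto simp: w_def Q)
        \<comment> \<open>Where |Im z| = T, the first factor is the real number Re z - \<alpha>.
          Thus \<open>K z ^ m\<close> supplies exactly the power of Re z - \<alpha> that
          \<open>inner\<close> asks for, while the second factor is O(T).\<close>
        have fac: "w\<^sup>2 + of_real T ^ 2 = (w - \<i> * of_real (Im z)) * (w + \<i> * of_real (Im z))"
          using 3 by (auto simp: algebra_simps power2_eq_square abs_if split: if_splits)
        have "w - \<i> * of_real (Im z) = of_real (Re z - \<alpha>)"
          by (simp add: w_def complex_eq_iff)
        hence "norm (w - \<i> * of_real (Im z)) = Re z - \<alpha>" using 3 by (simp only: norm_of_real)
        moreover have "norm (w + \<i> * of_real (Im z)) \<le> 3 * T"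
          using norm_triangle_ineq[of w "\<i> * of_real (Im z)"] w2 3 by (simp add: norm_mult)
        ultimately have "norm (w\<^sup>2 + of_real T ^ 2) \<le> (Re z - \<alpha>) * (3 * T)"
          unfolding fac norm_mult using 3 by (intro mult_mono) auto
        hence "norm (K z) \<le> (Re z - \<alpha>) * (3 * T) / T ^ 2"
          using T0 unfolding K_def norm_divide w_def[symmetric] by (simp add: norm_power divide_right_mono)
        also have "\<dots> = (Re z - \<alpha>) * (3 / T)" using T0 by (simp add: power2_eq_square)
        finally have "norm (K z) ^ m \<le> ((Re z - \<alpha>) * (3 / T)) ^ m" by (intro power_mono) auto
        hence "norm (F z) * norm (K z) ^ m \<le> norm (F z) * ((Re z - \<alpha>) * (3 / T)) ^ m"
          by (intro mult_left_mono) auto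
        also have "\<dots> = norm (F z) * (Re z - \<alpha>) ^ m * (3 / T) ^ m" by (simp only: power_mult_distrib mult.assoc)
        also have "\<dots> \<le> B * norm w ^ m * (3 / T) ^ m"
          using inner[of z] 3 z(1) T0 by (intro mult_right_mono) (auto simp: Q w_def)
        also have "\<dots> \<le> B * (2 * T) ^ m * (3 / T) ^ m"
          using w2 B T0 by (intro mult_right_mono mult_left_mono power_mono) auto
        also have "\<dots> = B * 2 ^ m * 3 ^ m" using T0 by (simp add: power_mult_distrib power_divide)
        finally have FK: "norm (F z) * norm (K z) ^ m \<le> B * 2 ^ m * 3 ^ m" .
        have "norm (H z) = norm (F z) * norm (K z) ^ m / norm z ^ N * norm (E \<epsilon> z)"
          by (simp add: H_def G_def norm_mult norm_power norm_divide)
        also have "\<dots> \<le> B * 2 ^ m * 3 ^ m / (\<alpha> - \<delta>) ^ N * e T"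
        proof (rule mult_mono)
          show "norm (F z) * norm (K z) ^ m / norm z ^ N \<le> B * 2 ^ m * 3 ^ m / (\<alpha> - \<delta>) ^ N"
            using FK z0 \<delta> B by (intro frac_le) auto
          show "norm (E \<epsilon> z) \<le> e T"
            unfolding E_def e_def using 3 \<delta> \<epsilon> z(1) strip_damping_factor[of \<delta> \<epsilon> z \<alpha>] by (auto simp: Q)
        qed (use B \<delta> in auto)
        also have "\<dots> = (B * 2 ^ m / (\<alpha> - \<delta>) ^ N * e T) * 3 ^ m" by simp
        also have "\<dots> \<le> D * 3 ^ m" using T2 by (intro mult_right_mono) auto
        finally show ?thesis by (simp add: mult.commute)
      qed
    qed
    moreover have "norm (K s) \<ge> 1 / 2"
    proof -
      have "norm (s - of_real \<alpha>) ^ 2 \<le> (T / 2) ^ 2" using T by (intro power_mono) auto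
      hence "norm (of_real T ^ 2 - (- (s - of_real \<alpha>)\<^sup>2)) \<ge> T ^ 2 / 2"
        using norm_triangle_ineq2[of "of_real T ^ 2" "- (s - of_real \<alpha>)\<^sup>2"] T0
        by (simp add: norm_power power_divide) (use zero_le_power2[of T] in linarith)
      thus ?thesis using T0 by (simp add: K_def norm_divide norm_power le_divide_eq add.commute)
    qed
    hence "norm (G s) * norm (E \<epsilon> s) * (1 / 2) ^ m \<le> norm (G s) * norm (E \<epsilon> s) * norm (K s) ^ m"
      by (intro mult_left_mono power_mono) auto
    ultimately have "norm (G s) * norm (E \<epsilon> s) * (1 / 2) ^ m \<le> 3 ^ m * D"
      by (simp add: H_def norm_mult norm_power)
    hence "norm (G s) * norm (E \<epsilon> s) \<le> 2 ^ m * (3 ^ m * D)"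
      by (simp add: field_simps)
    also have "2 ^ m * (3 ^ m * D) = (2 * 3) ^ m * D" unfolding power_mult_distrib by simp
    finally show ?thesis by simp
  qed
  \<comment> \<open>T was chosen in terms of \<epsilon> and s, but the bound is free of both, so
    \<epsilon> may tend to 0 with s fixed; \<open>E 0 s\<close> is 1.\<close>
  have "norm (G s) * norm (E 0 s) \<le> 6 ^ m * D"
  proof (rule tendsto_upperbound)
    show "((\<lambda>\<epsilon>. norm (G s) * norm (E \<epsilon> s)) \<longlongrightarrow> norm (G s) * norm (E 0 s)) (at_right 0)"
      unfolding E_def by (intro tendsto_intros)
    show "\<forall>\<^sub>F \<epsilon> in at_right 0. norm (G s) * norm (E \<epsilon> s) \<le> 6 ^ m * D"
      using main by (auto simp: eventually_at_right_less intro: eventually_mono[OF eventually_at_right_less])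
  qed auto
  hence "norm (F s) / norm s ^ N \<le> 6 ^ m * D"
    by (simp add: E_def G_def norm_divide norm_power)
  thus ?thesis using strip_ge[of s] s by (simp add: divide_le_eq)
qed

section \<open>Hypothesis B: convergence right of the pole and a uniform bound in the strip\<close>

lemma hypothesis_B_regular_part:
  assumes B: "hypothesis_B \<alpha> \<delta> \<kappa> m C a lam A" and \<delta>: "\<delta> > 0"
  obtains S F where "open S" "{s. Re s \<ge> \<alpha> - \<delta>} \<subseteq> S" "F holomorphic_on S"
    "A holomorphic_on S - {of_real \<alpha>}" "\<And>s. s \<noteq> of_real \<alpha> \<Longrightarrow> F s = (s - of_real \<alpha>) ^ m * A s"
proof -
  let ?\<alpha> = "complex_of_real \<alpha>"
  have an: "A analytic_on {s. Re s \<ge> \<alpha> - \<delta>} - {?\<alpha>}" and pole: "is_pole A ?\<alpha>"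
    and zo: "zorder A ?\<alpha> = - int m"
    using B by (auto simp: hypothesis_B_def)
  obtain T where T: "open T" "{s. Re s \<ge> \<alpha> - \<delta>} - {?\<alpha>} \<subseteq> T" "A holomorphic_on T"
    using an by (auto simp: analytic_on_holomorphic)
  \<comment> \<open>\<open>T\<close> may miss \<alpha>; the ball fills this gap, and its radius
    keeps the rest of it inside \<open>T\<close>.\<close>
  define S where "S = T \<union> ball ?\<alpha> \<delta>"
  have S: "open S" "?\<alpha> \<in> S" using T(1) \<delta> by (auto simp: S_def)
  have "Re s \<ge> \<alpha> - \<delta>" if "s \<in> ball ?\<alpha> \<delta>" for s
    using abs_Re_le_cmod[of "?\<alpha> - s"] that by (simp add: dist_norm)
  hence "S - {?\<alpha>} \<subseteq> T" using T(2) unfolding S_def by blast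
  hence A: "A holomorphic_on S - {?\<alpha>}" by (rule holomorphic_on_subset[OF T(3)])
  obtain g r where r: "r > 0" "cball ?\<alpha> r \<subseteq> S" "g holomorphic_on cball ?\<alpha> r"
      "\<And>w. w \<in> cball ?\<alpha> r - {?\<alpha>} \<Longrightarrow> A w = g w / (w - ?\<alpha>) ^ m"
    using zorder_exist_pole[OF A S pole] unfolding zo by auto
  \<comment> \<open>The value of A at \<alpha> is arbitrary, so F takes its value there from the
    holomorphic factor \<open>g\<close> of the pole.\<close>
  define F where "F = (\<lambda>s. if s = ?\<alpha> then g ?\<alpha> else (s - ?\<alpha>) ^ m * A s)"
  have gF: "F s = g s" if "s \<in> ball ?\<alpha> r" for s
    using r(4)[of s] that by (auto simp: F_def)
  show ?thesis
  proof (rule that[of S F])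
    show "{s. Re s \<ge> \<alpha> - \<delta>} \<subseteq> S" using T(2) \<delta> by (auto simp: S_def)
    have "F holomorphic_on S - {?\<alpha>}"
      by (rule holomorphic_transform[where f = "\<lambda>s. (s - ?\<alpha>) ^ m * A s"])
         (auto intro!: holomorphic_intros A simp: F_def)
    moreover have "F holomorphic_on ball ?\<alpha> r"
      using holomorphic_on_subset[OF r(3) ball_subset_cball] by (rule holomorphic_transform) (simp add: gF)
    ultimately have "F holomorphic_on (S - {?\<alpha>}) \<union> ball ?\<alpha> r"
      using S by (intro holomorphic_on_Un) (auto intro: open_delete)
    moreover have "(S - {?\<alpha>}) \<union> ball ?\<alpha> r = S"
      using r(1,2) S(2) ball_subset_cball[of ?\<alpha> r] by auto
    ultimately show "F holomorphic_on S" by simp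
  qed (use S A in \<open>auto simp: F_def\<close>)
qed

text \<open>The third claim is the triangle inequality for nonnegative coefficients. On Re s =
  \<alpha> + \<delta> it replaces A by one number, which is how A(\<alpha> + \<delta>) enters the
  constants.\<close>

lemma hypothesis_B_series:
  assumes B: "hypothesis_B \<alpha> \<delta> \<kappa> m C a lam A" and \<delta>: "\<delta> > 0" and s: "Re s > \<alpha>"
  shows "(\<lambda>n. complex_of_real (a n) * complex_of_real (lam n) powr (-s)) sums A s"
    and "summable (\<lambda>n. a n * lam n powr (- Re s))"
    and "norm (A s) \<le> norm (A (of_real (Re s)))"
proof -
  have dat: "dirichlet_data a lam" and ser: "has_dirichlet_series A a lam"
    using B by (auto simp: hypothesis_B_def)
  note [simp] = dirichlet_dataD[OF dat]
  have "A analytic_on {s. Re s > \<alpha>}"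
    by (rule analytic_on_subset[of _ "{s. Re s \<ge> \<alpha> - \<delta>} - {of_real \<alpha>}"])
       (use B \<delta> in \<open>auto simp: hypothesis_B_def\<close>)
  hence holo: "A holomorphic_on {s. Re s > \<alpha>}" by (rule analytic_imp_holomorphic)
  have sums: "(\<lambda>n. complex_of_real (a n) * complex_of_real (lam n) powr (-z)) sums A z"
    if "Re z > \<alpha>" for z
    by (rule dirichlet_landau_sums[OF dat ser holo that])
  from s show "(\<lambda>n. complex_of_real (a n) * complex_of_real (lam n) powr (-s)) sums A s"
    by (rule sums)
  show summ: "summable (\<lambda>n. a n * lam n powr (- Re s))"
    by (rule dirichlet_landau_summable[OF dat ser holo s])
  have "(\<lambda>n. complex_of_real (a n * lam n powr (- Re s))) sums A (of_real (Re s))"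
    using sums[of "of_real (Re s)"] s dirichlet_term_of_real[of "lam n" "a n" "Re s" for n] by simp
  hence eq: "A (of_real (Re s)) = of_real (\<Sum>n. a n * lam n powr (- Re s))"
    by (rule sums_unique2[OF _ sums_of_real[OF summable_sums[OF summ]]])
  have "norm (A s) \<le> (\<Sum>n. a n * lam n powr (- Re s))"
    using sums_unique[OF sums[OF s]] summ
    by (simp, intro order_trans[OF summable_norm]) (auto simp: norm_dirichlet_term)
  also have "\<dots> \<le> norm (A (of_real (Re s)))"
    unfolding eq norm_of_real by simp
  finally show "norm (A s) \<le> norm (A (of_real (Re s)))" .
qed

text \<open>\<open>D\<close> is obtained before \<open>a\<close>, \<open>lam\<close> and
  \<open>A\<close>, and this order carries the uniformity of the final constant. The exponent N is
  dictated by the left edge: m from the factor at the pole, \<kappa> from the growth of A, and m - 1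
  from bounding the logarithm linearly.\<close>

lemma hypothesis_B_strip_bound:
  fixes \<alpha> \<delta> \<kappa> C :: real and m N :: nat and v :: complex
  assumes \<delta>: "0 < \<delta>" "\<delta> < \<alpha>" and "\<kappa> > 0" "m \<ge> 1" "C \<ge> 1" and N: "real N \<ge> \<kappa> + 2 * real m"
  obtains D where "D > 0"
    "\<And>a lam A s. hypothesis_B \<alpha> \<delta> \<kappa> m C a lam A \<Longrightarrow> A (of_real (\<alpha> + \<delta>)) = v \<Longrightarrow>
       \<alpha> - \<delta> \<le> Re s \<Longrightarrow> Re s \<le> \<alpha> + \<delta> \<Longrightarrow> norm ((s - of_real \<alpha>) ^ m * A s) \<le> D * norm s ^ N"
proof -
  \<comment> \<open>In the strip |s| \<ge> \<alpha> - \<delta>, so c |s| \<ge> |s| + 3 + \<alpha>.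
    This dominates |s - \<alpha>|, 1 + |Im s| and 3 + |Im s| at once.\<close>
  define c where "c = 1 + (3 + \<alpha>) / (\<alpha> - \<delta>)"
  have c: "c \<ge> 1" using \<delta> by (simp add: c_def)
  define D0 where "D0 = (C + norm v) * c ^ N"
  have D0: "D0 > 0" using assms c by (simp add: D0_def add_pos_nonneg)
  show ?thesis
  proof (rule that[of "6 ^ m * D0"])
    show "6 ^ m * D0 > 0" using D0 by simp
    fix a lam A s
    assume B: "hypothesis_B \<alpha> \<delta> \<kappa> m C a lam A" and v: "A (complex_of_real (\<alpha> + \<delta>)) = v"
      and s: "\<alpha> - \<delta> \<le> Re s" "Re s \<le> \<alpha> + \<delta>"
    obtain S F where F: "open S" "{s. Re s \<ge> \<alpha> - \<delta>} \<subseteq> S" "F holomorphic_on S"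
      "\<And>s. s \<noteq> of_real \<alpha> \<Longrightarrow> F s = (s - of_real \<alpha>) ^ m * A s"
      using hypothesis_B_regular_part[OF B \<delta>(1)] by metis
    obtain M1 M2 where M: "M1 \<ge> 0" "M2 \<ge> 0"
      "\<And>s. \<alpha> - \<delta> \<le> Re s \<Longrightarrow> Re s \<le> \<alpha> \<Longrightarrow> norm ((s - of_real \<alpha>) ^ m * A s) \<le> M1 * exp (norm s powr M2)"
      using B by (auto simp: hypothesis_B_def)
    have lft: "norm (A s) \<le> C * (1 + \<bar>Im s\<bar>) powr \<kappa> * ln (3 + \<bar>Im s\<bar>) ^ (m - 1)" if "Re s = \<alpha> - \<delta>" for s
      using B that by (auto simp: hypothesis_B_def)
    have w: "norm (s - of_real \<alpha>) \<le> c * norm s" "1 + \<bar>Im s\<bar> \<le> c * norm s" "3 + \<bar>Im s\<bar> \<le> c * norm s"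
      if "Re s \<ge> \<alpha> - \<delta>" for s
    proof -
      have "(3 + \<alpha>) / (\<alpha> - \<delta>) * norm s \<ge> (3 + \<alpha>) / (\<alpha> - \<delta>) * (\<alpha> - \<delta>)"
        using that \<delta> complex_Re_le_cmod[of s] by (intro mult_left_mono) auto
      also have "(3 + \<alpha>) / (\<alpha> - \<delta>) * (\<alpha> - \<delta>) = 3 + \<alpha>" using \<delta> by simp
      finally have *: "c * norm s \<ge> norm s + 3 + \<alpha>" unfolding c_def distrib_right by linarith
      have "norm (s - of_real \<alpha>) \<le> norm s + \<alpha>"
        using norm_triangle_ineq4[of s "of_real \<alpha>"] \<delta> by simp
      with * show "norm (s - of_real \<alpha>) \<le> c * norm s" by simp
      show "1 + \<bar>Im s\<bar> \<le> c * norm s" "3 + \<bar>Im s\<bar> \<le> c * norm s"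
        using * abs_Im_le_cmod[of s] \<delta> by auto
    qed
    have compact: "compact (complex_of_real ` {\<alpha>..\<alpha> + \<delta>})"
      by (intro compact_continuous_image continuous_intros) auto
    have "continuous_on (complex_of_real ` {\<alpha>..\<alpha> + \<delta>}) F"
      using F(2) \<delta> by (intro holomorphic_on_imp_continuous_on holomorphic_on_subset[OF F(3)]) auto
    hence "bounded (F ` complex_of_real ` {\<alpha>..\<alpha> + \<delta>})"
      using compact by (rule compact_imp_bounded[OF compact_continuous_image])
    then obtain B0 where "\<forall>z\<in>F ` complex_of_real ` {\<alpha>..\<alpha> + \<delta>}. norm z \<le> B0"
      unfolding bounded_iff by blast
    hence B0: "norm (F (of_real x)) \<le> B0" if "\<alpha> \<le> x" "x \<le> \<alpha> + \<delta>" for x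
      using that by simp
    have "norm (F s) \<le> 6 ^ m * D0 * norm s ^ N"
    \<comment> \<open>\<open>M1\<close> is enlarged because at \<alpha> the hypothesis bounds only
      0, not F. Neither it nor \<open>B0\<close> occurs in the conclusion, so both may vary with
      A.\<close>
    proof (rule strip_polynomial_bound[where S = S and ?M1.0 = "M1 + norm (F (of_real \<alpha>))" and ?M2.0 = M2 and B = B0])
      fix s assume s: "Re s = \<alpha> - \<delta>"
      hence ne: "s \<noteq> of_real \<alpha>" using \<delta> by auto
      define W where "W = c * norm s"
      have W: "norm (s - of_real \<alpha>) \<le> W" "1 + \<bar>Im s\<bar> \<le> W" "3 + \<bar>Im s\<bar> \<le> W"
        using w[of s] s by (auto simp: W_def)
      have lnW: "ln (3 + \<bar>Im s\<bar>) \<le> W" using ln_le_minus_one[of "3 + \<bar>Im s\<bar>"] W by linarith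
      have "norm (F s) = norm (s - of_real \<alpha>) ^ m * norm (A s)"
        by (simp add: F(4)[OF ne] norm_mult norm_power)
      also have "\<dots> \<le> W ^ m * (C * W powr \<kappa> * W ^ (m - 1))"
      proof (intro mult_mono power_mono)
        have "C * (1 + \<bar>Im s\<bar>) powr \<kappa> * ln (3 + \<bar>Im s\<bar>) ^ (m - 1) \<le> C * W powr \<kappa> * W ^ (m - 1)"
          using W lnW assms by (intro mult_mono powr_mono2 power_mono) auto
        with lft[OF s] show "norm (A s) \<le> C * W powr \<kappa> * W ^ (m - 1)" by linarith
      qed (use W in auto)
      also have "\<dots> = C * (W powr (real m + \<kappa> + real (m - 1)))"
        using W by (simp add: powr_add powr_realpow)
      also have "\<dots> \<le> C * W powr (real N)"
        using W assms by (intro mult_left_mono powr_mono) (auto simp: of_nat_diff)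
      also have "\<dots> = C * W ^ N" using W by (simp add: powr_realpow)
      also have "\<dots> \<le> (C + norm v) * W ^ N" using W by (intro mult_right_mono) auto
      finally show "norm (F s) \<le> D0 * norm s ^ N" by (simp add: W_def D0_def power_mult_distrib)
    next
      fix s assume s: "Re s = \<alpha> + \<delta>"
      hence ne: "s \<noteq> of_real \<alpha>" using \<delta> by auto
      define W where "W = c * norm s"
      have W: "norm (s - of_real \<alpha>) \<le> W" "1 + \<bar>Im s\<bar> \<le> W"
        using w[of s] s \<delta> by (auto simp: W_def)
      have "norm (F s) = norm (s - of_real \<alpha>) ^ m * norm (A s)"
        by (simp add: F(4)[OF ne] norm_mult norm_power)
      also have "\<dots> \<le> W ^ m * norm v"
        using hypothesis_B_series(3)[OF B \<delta>(1), of s] s \<delta> v W by (intro mult_mono power_mono) auto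
      also have "\<dots> \<le> W ^ N * (C + norm v)"
        using W N assms by (intro mult_mono power_increasing) auto
      finally show "norm (F s) \<le> D0 * norm s ^ N" by (simp add: W_def D0_def power_mult_distrib mult_ac)
    next
      fix s assume s: "\<alpha> - \<delta> \<le> Re s" "Re s \<le> \<alpha>"
      show "norm (F s) \<le> (M1 + norm (F (of_real \<alpha>))) * exp (norm s powr M2)"
      proof (cases "s = of_real \<alpha>")
        case True
        have "1 * norm (F s) \<le> exp (norm s powr M2) * norm (F s)"
          by (intro mult_right_mono) auto
        also have "\<dots> \<le> exp (norm s powr M2) * (M1 + norm (F (of_real \<alpha>)))"
          using True M by (intro mult_left_mono) auto
        finally show ?thesis by (simp add: mult.commute)
      next
        case False
        hence "norm (F s) \<le> M1 * exp (norm s powr M2)" using F(4)[OF False] M(3)[OF s] by simp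
        also have "\<dots> \<le> (M1 + norm (F (of_real \<alpha>))) * exp (norm s powr M2)"
          by (intro mult_right_mono) auto
        finally show ?thesis .
      qed
    next
      fix s assume s: "\<alpha> < Re s" "Re s \<le> \<alpha> + \<delta>"
      have ne: "s \<noteq> of_real \<alpha>" "complex_of_real (Re s) \<noteq> of_real \<alpha>" using s by auto
      have "norm (complex_of_real (Re s) - of_real \<alpha>) = Re s - \<alpha>"
        using s by (simp flip: of_real_diff)
      hence eq: "norm (F (of_real (Re s))) = (Re s - \<alpha>) ^ m * norm (A (of_real (Re s)))"
        unfolding F(4)[OF ne(2)] norm_mult norm_power by simp
      \<comment> \<open>Replacing A(s) by A(Re s) transfers the estimate to the real segment from
        \<alpha> to \<alpha> + \<delta>, where F is bounded by compactness.\<close>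
      have "norm (F s) * (Re s - \<alpha>) ^ m = norm (s - of_real \<alpha>) ^ m * (norm (A s) * (Re s - \<alpha>) ^ m)"
        by (simp add: F(4)[OF ne(1)] norm_mult norm_power)
      also have "\<dots> \<le> norm (s - of_real \<alpha>) ^ m * (norm (A (of_real (Re s))) * (Re s - \<alpha>) ^ m)"
        using hypothesis_B_series(3)[OF B \<delta>(1) s(1)] s by (intro mult_left_mono mult_right_mono) auto
      also have "\<dots> \<le> norm (s - of_real \<alpha>) ^ m * B0"
        using B0[of "Re s"] s eq by (intro mult_left_mono) (auto simp: mult.commute)
      finally show "norm (F s) * (Re s - \<alpha>) ^ m \<le> B0 * norm (s - of_real \<alpha>) ^ m"
        by (simp only: mult.commute)
    qed (use \<delta> D0 M(1,2) F(2,3) s in auto)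
    \<comment> \<open>At s = \<alpha> the left side is 0 since m \<ge> 1, whatever A takes
      there.\<close>
    thus "norm ((s - of_real \<alpha>) ^ m * A s) \<le> 6 ^ m * D0 * norm s ^ N"
      using F(4)[of s] D0 assms(4) by (cases "s = of_real \<alpha>") (auto simp: power_0_left)
  qed
qed

section \<open>Estimates for the smoothed kernel\<close>

text \<open>A mean value bound along the segment from 0 to z. Only |Re z| stands in the exponent,
  which makes the bound usable at every height of a vertical line.\<close>

lemma norm_exp_minus_1_le: "norm (exp z - 1) \<le> exp \<bar>Re z\<bar> * norm (z::complex)"
proof -
  have "norm (exp z - exp 0) \<le> exp \<bar>Re z\<bar> * norm (z - 0)"
  proof (rule field_differentiable_bound[where S = "closed_segment 0 z"])
    fix w assume "w \<in> closed_segment 0 z"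
    then obtain t where t: "0 \<le> t" "t \<le> 1" "w = of_real t * z"
      by (auto simp: closed_segment_def scaleR_conv_of_real)
    have "t * Re z \<le> \<bar>t * Re z\<bar>" by simp
    also have "\<dots> = t * \<bar>Re z\<bar>" using t by (simp add: abs_mult)
    also have "\<dots> \<le> 1 * \<bar>Re z\<bar>" using t by (intro mult_right_mono) auto
    finally show "norm (exp w) \<le> exp \<bar>Re z\<bar>" using t by simp
  qed (auto intro!: derivative_eq_intros)
  thus ?thesis by simp
qed

lemma norm_exp_minus_1_minus_le: "norm (exp z - 1 - z) \<le> exp (norm z) * norm (z::complex) ^ 2"
proof -
  have "norm ((exp z - z) - (exp 0 - 0)) \<le> exp (norm z) * norm z * norm (z - 0)"
  proof (rule field_differentiable_bound[where S = "closed_segment 0 z" and f' = "\<lambda>w. exp w - 1"])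
    fix w assume "w \<in> closed_segment 0 z"
    hence w: "norm w \<le> norm z" using segment_bound1 by force
    have "norm (exp w - 1) \<le> exp \<bar>Re w\<bar> * norm w" by (rule norm_exp_minus_1_le)
    also have "\<dots> \<le> exp (norm z) * norm z"
      using w abs_Re_le_cmod[of w] by (intro mult_mono) auto
    finally show "norm (exp w - 1) \<le> exp (norm z) * norm z" .
  qed (auto intro!: derivative_eq_intros)
  thus ?thesis by (simp add: power2_eq_square algebra_simps)
qed

text \<open>Three regimes: the first bound serves heights up to about 1 / |h|, the second the
  heights beyond, the third the small circle around the pole.\<close>

lemma norm_boxker_le:
  assumes "h \<noteq> 0" "s \<noteq> 0"
  shows "norm (boxker h s) \<le> exp (\<bar>h\<bar> * \<bar>Re s\<bar>)"
    and "norm (boxker h s) \<le> 2 * exp (\<bar>h\<bar> * \<bar>Re s\<bar>) / (\<bar>h\<bar> * norm s)"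
    and "norm (boxker h s - 1) \<le> exp (\<bar>h\<bar> * norm s) * (\<bar>h\<bar> * norm s)"
proof -
  have nz: "norm (of_real h * s) > 0" using assms by simp
  have "norm (exp (of_real h * s) - 1) \<le> exp (\<bar>h\<bar> * \<bar>Re s\<bar>) * norm (of_real h * s)"
    using norm_exp_minus_1_le[of "of_real h * s"] by (simp add: abs_mult)
  thus "norm (boxker h s) \<le> exp (\<bar>h\<bar> * \<bar>Re s\<bar>)"
    using nz unfolding boxker_def norm_divide by (simp only: divide_le_eq if_True)
  have "norm (exp (of_real h * s) - 1) \<le> exp (h * Re s) + 1"
    using norm_triangle_ineq4[of "exp (of_real h * s)" 1] by simp
  also have "\<dots> \<le> exp (\<bar>h\<bar> * \<bar>Re s\<bar>) + exp (\<bar>h\<bar> * \<bar>Re s\<bar>)"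
    by (intro add_mono) (auto simp flip: abs_mult)
  finally show "norm (boxker h s) \<le> 2 * exp (\<bar>h\<bar> * \<bar>Re s\<bar>) / (\<bar>h\<bar> * norm s)"
    unfolding boxker_def norm_divide norm_mult norm_of_real by (intro divide_right_mono) auto
  have "boxker h s - 1 = (exp (of_real h * s) - 1 - of_real h * s) / (of_real h * s)"
    using assms by (simp add: boxker_def field_simps)
  hence "norm (boxker h s - 1) \<le> exp (norm (of_real h * s)) * norm (of_real h * s) ^ 2 / norm (of_real h * s)"
    using norm_exp_minus_1_minus_le[of "of_real h * s"] nz by (simp only: norm_divide divide_right_mono norm_ge_zero)
  also have "\<dots> = exp (norm (of_real h * s)) * norm (of_real h * s)"
    using nz by (simp add: power2_eq_square)
  finally show "norm (boxker h s - 1) \<le> exp (\<bar>h\<bar> * norm s) * (\<bar>h\<bar> * norm s)"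
    by (simp add: norm_mult)
qed

lemma norm_power_minus_1_le:
  assumes "norm (w::complex) \<le> R" "R \<ge> 1"
  shows "norm (w ^ k - 1) \<le> k * R ^ k * norm (w - 1)"
proof (induction k)
  case (Suc k)
  have "w ^ Suc k - 1 = w * (w ^ k - 1) + (w - 1)" by (simp add: algebra_simps)
  hence "norm (w ^ Suc k - 1) \<le> norm w * norm (w ^ k - 1) + norm (w - 1)"
    using norm_triangle_ineq[of "w * (w ^ k - 1)" "w - 1"] by (simp only: norm_mult)
  also have "\<dots> \<le> R * (k * R ^ k * norm (w - 1)) + R ^ Suc k * norm (w - 1)"
    using assms Suc one_le_power[of R "Suc k"] mult_right_mono[of 1 "R ^ Suc k" "norm (w - 1)"]
    by (intro add_mono mult_mono) auto
  also have "\<dots> = Suc k * R ^ Suc k * norm (w - 1)" by (simp add: algebra_simps)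
  finally show ?case .
qed auto

text \<open>The profile follows (1 + |t|)^(\<kappa> - 1) until (1 + |t|)^\<kappa> reaches P and then
  decays like |t|^(-\<kappa> - 1). It is chosen for its closed antiderivative: with u = (1 +
  t)^\<kappa>, this is (P / \<kappa>) u / (P + u) for t \<ge> 0.\<close>

lemma kernel_profile_integral:
  fixes \<kappa> P :: real
  assumes "\<kappa> > 0" "P > 0"
  defines "\<phi> \<equiv> (\<lambda>t. (1 + \<bar>t\<bar>) powr (\<kappa> - 1) / (1 + (1 + \<bar>t\<bar>) powr \<kappa> / P)\<^sup>2)"
  shows "integrable lborel \<phi>" "(LINT t|lborel. \<phi> t) \<le> 2 * P / \<kappa>"
proof -
  define F where "F = (\<lambda>t::real. P / \<kappa> * ((1 + t) powr \<kappa> / (P + (1 + t) powr \<kappa>)))"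
  have *: "has_bochner_integral lborel \<phi> (2 * (P / \<kappa> * 1 - F 0))"
  proof (rule has_bochner_integral_even_FTC)
    show "\<phi> \<in> borel_measurable borel" unfolding \<phi>_def by measurable
    show "(F \<longlongrightarrow> P / \<kappa> * 1) at_top"
      unfolding F_def using assms by (intro tendsto_mult tendsto_const) real_asymp
    fix t :: real assume t: "t \<ge> 0"
    define u where "u = (1 + t) powr \<kappa>"
    have u: "u > 0" using t by (simp add: u_def)
    have d: "((\<lambda>t. (1 + t) powr \<kappa>) has_real_derivative (\<kappa> * (1 + t) powr (\<kappa> - 1))) (at t)"
      using t by (auto intro!: derivative_eq_intros)
    have "(F has_real_derivative P / \<kappa> * ((\<kappa> * (1 + t) powr (\<kappa> - 1) * (P + u) - u * (\<kappa> * (1 + t) powr (\<kappa> - 1))) / ((P + u) * (P + u)))) (at t)"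
      unfolding F_def u_def using assms u u_def
      by (intro DERIV_cmult DERIV_divide d DERIV_add[OF DERIV_const d, simplified]) (auto simp: add_nonneg_eq_0_iff)
    also have "P / \<kappa> * ((\<kappa> * (1 + t) powr (\<kappa> - 1) * (P + u) - u * (\<kappa> * (1 + t) powr (\<kappa> - 1))) / ((P + u) * (P + u)))
        = (1 + t) powr (\<kappa> - 1) * (P / (P + u))\<^sup>2"
      using assms by (simp add: power2_eq_square field_simps)
    also have "P / (P + u) = 1 / (1 + u / P)" using assms u by (simp add: field_simps)
    also have "(1 + t) powr (\<kappa> - 1) * (1 / (1 + u / P))\<^sup>2 = \<phi> t"
      using t by (simp add: \<phi>_def u_def power_divide)
    finally show "(F has_real_derivative \<phi> t) (at t)" .
  qed (use assms in \<open>auto simp: \<phi>_def\<close>)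
  thus "integrable lborel \<phi>" by (rule integrable.intros)
  have "F 0 \<ge> 0" using assms by (simp add: F_def)
  thus "(LINT t|lborel. \<phi> t) \<le> 2 * P / \<kappa>" using has_bochner_integral_integral_eq[OF *] by simp
qed

text \<open>Of the k cutoff factors r = min 1 (U / u), j are spent on the logarithms: for u > U, ln
  (2 + u) exceeds ln (2 + U) by at most u / U, which r reduces to 1 \<le> ln (2 + U). The other k -
  j \<ge> 2 \<kappa> factors give the squared profile, since min 1 (1 / y) \<le> 2 / (1 +
  y).\<close>

lemma log_power_cutoff_le:
  fixes u U \<kappa> :: real
  assumes "u \<ge> 1" "U \<ge> 1" "\<kappa> > 0" and k: "real k \<ge> real j + 2 * \<kappa>"
  shows "ln (2 + u) ^ j * min 1 (U / u) ^ k \<le> (2 * ln (2 + U)) ^ j * (4 / (1 + u powr \<kappa> / U powr \<kappa>)\<^sup>2)"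
proof -
  define r where "r = min 1 (U / u)"
  have r: "0 < r" "r \<le> 1" using assms by (auto simp: r_def)
  have "exp 1 \<le> (3::real)" by (rule exp_le)
  hence ln1: "ln (2 + U) \<ge> 1" using assms by (subst ln_ge_iff) auto
  have "ln (2 + u) * r \<le> 2 * ln (2 + U)"
  proof (cases "u \<le> U")
    case True
    have "ln (2 + u) * r \<le> ln (2 + U) * 1" using True assms r by (intro mult_mono) auto
    thus ?thesis using ln1 by linarith
  next
    case False
    have "ln (2 + u) = ln (2 + U) + ln ((2 + u) / (2 + U))"
      using assms by (simp add: ln_div)
    also have "ln ((2 + u) / (2 + U)) \<le> (2 + u) / (2 + U) - 1"
      using assms by (intro ln_le_minus_one) auto
    also have "(2 + u) / (2 + U) - 1 \<le> u / U"
      using assms by (simp add: field_simps)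
    finally have "ln (2 + u) \<le> ln (2 + U) + u / U" by simp
    hence "ln (2 + u) * r \<le> (ln (2 + U) + u / U) * r" using r by (intro mult_right_mono) auto
    also have "\<dots> = ln (2 + U) * r + 1" using False assms by (simp add: r_def algebra_simps)
    also have "\<dots> \<le> ln (2 + U) * 1 + ln (2 + U)" using r ln1 by (intro add_mono mult_left_mono) auto
    finally show ?thesis by simp
  qed
  hence 1: "(ln (2 + u) * r) ^ j \<le> (2 * ln (2 + U)) ^ j"
    using r assms by (intro power_mono) auto
  have jk: "j \<le> k" using k assms by linarith
  have "r ^ (k - j) = r powr (real (k - j))" using r by (simp add: powr_realpow)
  also have "\<dots> \<le> r powr (2 * \<kappa>)" using r k jk by (intro powr_mono') (auto simp: of_nat_diff)
  also have "\<dots> = (r powr \<kappa>)\<^sup>2" using r by (simp add: power2_eq_square flip: powr_add)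
  also have "\<dots> \<le> (2 / (1 + u powr \<kappa> / U powr \<kappa>))\<^sup>2"
  proof (rule power_mono)
    define y where "y = u powr \<kappa> / U powr \<kappa>"
    have y: "y > 0" using assms by (simp add: y_def)
    have "r powr \<kappa> = min 1 (1 / y)"
    proof (cases "u \<le> U")
      case True
      hence "u powr \<kappa> \<le> U powr \<kappa>" using assms by (intro powr_mono2) auto
      thus ?thesis using True assms by (auto simp: r_def y_def min_def field_simps)
    next
      case False
      hence "U powr \<kappa> < u powr \<kappa>" using assms by (intro powr_less_mono2) auto
      thus ?thesis using False assms by (auto simp: r_def y_def min_def powr_divide field_simps)
    qed
    also have "\<dots> \<le> 2 / (1 + y)"
      using y by (cases "y \<le> 1") (auto simp: min_def field_simps)
    finally show "r powr \<kappa> \<le> 2 / (1 + u powr \<kappa> / U powr \<kappa>)" by (simp add: y_def)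
  qed auto
  finally have 2: "r ^ (k - j) \<le> 4 / (1 + u powr \<kappa> / U powr \<kappa>)\<^sup>2" by (simp add: power_divide)
  have "ln (2 + u) ^ j * r ^ k = (ln (2 + u) * r) ^ j * r ^ (k - j)"
    using jk by (simp add: power_mult_distrib flip: power_add)
  also have "\<dots> \<le> (2 * ln (2 + U)) ^ j * (4 / (1 + u powr \<kappa> / U powr \<kappa>)\<^sup>2)"
    using 1 2 r ln1 by (intro mult_mono) auto
  finally show ?thesis by (simp add: r_def)
qed

section \<open>The smoothed counting function\<close>

definition smoothed_integrand :: "(complex \<Rightarrow> complex) \<Rightarrow> real \<Rightarrow> real \<Rightarrow> nat \<Rightarrow> complex \<Rightarrow> complex" where
  "smoothed_integrand A x h k s = A s * (exp (of_real (ln x) * s) / s * boxker h s ^ k)"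

lemma hypothesis_B_holomorphic:
  assumes B: "hypothesis_B \<alpha> \<delta> \<kappa> m C a lam A" and \<delta>: "0 < \<delta>" "\<delta> < \<alpha>" and h: "h \<noteq> 0"
  obtains S where "open S" "{s. Re s \<ge> \<alpha> - \<delta>} \<subseteq> S" "0 \<notin> S" "A holomorphic_on S - {of_real \<alpha>}"
    "smoothed_integrand A x h k holomorphic_on S - {of_real \<alpha>}"
proof -
  obtain S F where S: "open S" "{s. Re s \<ge> \<alpha> - \<delta>} \<subseteq> S" "A holomorphic_on S - {of_real \<alpha>}"
    using hypothesis_B_regular_part[OF B \<delta>(1)] by metis
  show ?thesis
  \<comment> \<open>The open set may extend beyond the half-plane and contain 0, where the kernel is
    singular.\<close>
  proof (rule that[of "S - {0}"])
    show "A holomorphic_on S - {0} - {of_real \<alpha>}" using S(3) by (rule holomorphic_on_subset) auto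
    thus "smoothed_integrand A x h k holomorphic_on S - {0} - {of_real \<alpha>}"
      unfolding smoothed_integrand_def[abs_def] boxker_def using h by (intro holomorphic_intros) auto
  qed (use S \<delta> in \<open>auto intro: open_delete\<close>)
qed

text \<open>On Re s = \<alpha> + \<delta> the series converges absolutely and may be integrated term
  by term, so W is the sum of the a_n with the weights from \<open>smoothed_perron\<close>.\<close>

lemma smoothed_sum_sandwich:
  assumes B: "hypothesis_B \<alpha> \<delta> \<kappa> m C a lam A" and \<delta>: "0 < \<delta>" "\<delta> < \<alpha>" and h: "h \<noteq> 0" and k: "k \<ge> 1"
    and x: "x > 0"
  obtains W :: real where "integrable lborel (\<lambda>t. smoothed_integrand A x h k (Complex (\<alpha> + \<delta>) t))"
    "(LINT t|lborel. smoothed_integrand A x h k (Complex (\<alpha> + \<delta>) t)) = 2 * pi * W"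
    "h > 0 \<Longrightarrow> (\<Sum>n | lam n \<le> x. a n) \<le> W" "h < 0 \<Longrightarrow> W \<le> (\<Sum>n | lam n \<le> x. a n)"
proof -
  define c where "c = \<alpha> + \<delta>"
  have c: "c > 0" "c > \<alpha>" using \<delta> by (auto simp: c_def)
  have dat: "dirichlet_data a lam" using B by (auto simp: hypothesis_B_def)
  note dd [simp] = dirichlet_dataD[OF dat]
  define g where "g = (\<lambda>u t. exp (of_real u * Complex c t) / Complex c t * boxker h (Complex c t) ^ k)"
  define u where "u = (\<lambda>n. ln x - ln (lam n))"
  have "\<forall>n. \<exists>w::real. integrable lborel (g (u n)) \<and> (LINT t|lborel. g (u n) t) = 2 * pi * w \<and> 0 \<le> w \<and> w \<le> 1 \<and>
      (h > 0 \<longrightarrow> u n \<ge> 0 \<longrightarrow> w = 1) \<and> (h < 0 \<longrightarrow> u n \<le> 0 \<longrightarrow> w = 0)"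
  proof
    fix n
    obtain w :: real where "integrable lborel (g (u n))" "(LINT t|lborel. g (u n) t) = 2 * pi * w" "0 \<le> w" "w \<le> 1"
      "h > 0 \<Longrightarrow> u n \<ge> 0 \<Longrightarrow> w = 1" "h < 0 \<Longrightarrow> u n \<le> 0 \<Longrightarrow> w = 0"
      using smoothed_perron[OF c(1) k h, of "u n"] unfolding g_def by blast
    thus "\<exists>w::real. integrable lborel (g (u n)) \<and> (LINT t|lborel. g (u n) t) = 2 * pi * w \<and> 0 \<le> w \<and> w \<le> 1 \<and>
      (h > 0 \<longrightarrow> u n \<ge> 0 \<longrightarrow> w = 1) \<and> (h < 0 \<longrightarrow> u n \<le> 0 \<longrightarrow> w = 0)" by blast
  qed
  then obtain w :: "nat \<Rightarrow> real" where w: "integrable lborel (g (u n))" "(LINT t|lborel. g (u n) t) = 2 * pi * w n"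
      "0 \<le> w n" "w n \<le> 1" "h > 0 \<Longrightarrow> u n \<ge> 0 \<Longrightarrow> w n = 1" "h < 0 \<Longrightarrow> u n \<le> 0 \<Longrightarrow> w n = 0" for n
    by metis
  have g0: "integrable lborel (g (ln x))"
    using smoothed_perron[OF c(1) k h, of "ln x"] unfolding g_def by blast
  \<comment> \<open>All terms are multiples of one integrable function, by factors whose moduli do
    not depend on t. This gives both the interchange of sum and integral and the integrability of
    the sum.\<close>
  have gu: "g (u n) t = of_real (lam n) powr (- Complex c t) * g (ln x) t" for n t
  proof -
    have nz: "lam n \<noteq> 0" using dd(3)[of n] by linarith
    show ?thesis using nz
      by (simp add: g_def u_def powr_def Ln_of_real algebra_simps flip: exp_add)
  qed
  have sumA: "(\<lambda>n. of_real (a n) * of_real (lam n) powr (- Complex c t)) sums A (Complex c t)" for t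
    by (rule hypothesis_B_series(1)[OF B \<delta>(1)]) (use c in auto)
  have summ: "summable (\<lambda>n. a n * lam n powr (- c))"
    using hypothesis_B_series(2)[OF B \<delta>(1), of "of_real c"] c by simp
  have norm_f: "norm (of_real (a n) * g (u n) t) = a n * lam n powr (- c) * norm (g (ln x) t)" for n t
    using norm_dirichlet_term[of "lam n" "a n" "Complex c t"]
    unfolding gu mult.assoc[symmetric] norm_mult[of "_ * _"] by simp
  have sums_f: "(\<lambda>n. of_real (a n) * g (u n) t) sums smoothed_integrand A x h k (Complex c t)" for t
  proof -
    have "smoothed_integrand A x h k (Complex c t) = A (Complex c t) * g (ln x) t"
      by (simp add: smoothed_integrand_def g_def)
    thus ?thesis
      using sums_mult2[OF sumA[of t], of "g (ln x) t"] unfolding gu by (simp only: mult.assoc)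
  qed
  have "(\<lambda>n. LINT t|lborel. of_real (a n) * g (u n) t) sums (LINT t|lborel. (\<Sum>n. of_real (a n) * g (u n) t))"
  proof (rule sums_integral)
    show "integrable lborel (\<lambda>t. of_real (a n) * g (u n) t)" for n using w(1)[of n] by simp
    show "AE t in lborel. summable (\<lambda>n. norm (of_real (a n) * g (u n) t))"
      unfolding norm_f by (intro always_eventually allI summable_mult2 summ)
    show "summable (\<lambda>n. LINT t|lborel. norm (of_real (a n) * g (u n) t))"
      unfolding norm_f by (simp add: summable_mult2 summ)
  qed
  moreover have "(\<Sum>n. of_real (a n) * g (u n) t) = smoothed_integrand A x h k (Complex c t)" for t
    using sums_f[of t] by (rule sums_unique[symmetric])
  moreover have "(LINT t|lborel. of_real (a n) * g (u n) t) = complex_of_real (2 * pi * (a n * w n))" for n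
    using w(2)[of n] by simp
  ultimately have sums: "(\<lambda>n. complex_of_real (2 * pi * (a n * w n))) sums
      (LINT t|lborel. smoothed_integrand A x h k (Complex c t))"
    by (simp only:)
  hence "summable (\<lambda>n. 2 * pi * (a n * w n))"
    by (metis summable_of_real_iff sums_summable)
  hence sw: "summable (\<lambda>n. a n * w n)" by (subst (asm) summable_cmult_iff) auto
  define W where "W = (\<Sum>n. a n * w n)"
  have "(LINT t|lborel. smoothed_integrand A x h k (Complex c t)) = complex_of_real (2 * pi * W)"
    unfolding W_def
    by (rule sums_unique2[OF sums]) (intro sums_of_real sums_mult summable_sums sw)
  moreover have "integrable lborel (\<lambda>t. smoothed_integrand A x h k (Complex c t))"
  proof (rule Bochner_Integration.integrable_bound)
    define M where "M = (\<Sum>n. a n * lam n powr (- c))"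
    show "integrable lborel (\<lambda>t. M * norm (g (ln x) t))" using g0 by simp
    have [measurable]: "(\<lambda>t. g (u n) t) \<in> borel_measurable lborel" for n
      using w(1)[of n] by (rule borel_measurable_integrable)
    have eq: "(\<lambda>t. smoothed_integrand A x h k (Complex c t)) = (\<lambda>t. \<Sum>n. of_real (a n) * g (u n) t)"
      using sums_f by (auto simp: fun_eq_iff sums_iff)
    show "(\<lambda>t. smoothed_integrand A x h k (Complex c t)) \<in> borel_measurable lborel"
      unfolding eq by measurable
    have "norm (smoothed_integrand A x h k (Complex c t)) \<le> M * norm (g (ln x) t)" for t
    proof -
      have "norm (\<Sum>n. of_real (a n) * g (u n) t) \<le> (\<Sum>n. norm (of_real (a n) * g (u n) t))"
        by (rule summable_norm) (unfold norm_f, intro summable_mult2 summ)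
      also have "\<dots> = M * norm (g (ln x) t)"
        unfolding norm_f M_def by (rule suminf_mult2[OF summ, symmetric])
      finally show ?thesis using sums_f[of t] by (simp add: sums_iff)
    qed
    thus "AE t in lborel. norm (smoothed_integrand A x h k (Complex c t)) \<le> norm (M * norm (g (ln x) t))"
      by (intro always_eventually allI) (simp add: order_trans[OF _ abs_ge_self])
  qed
  moreover have fin: "finite {n. lam n \<le> x}"
  proof -
    have "eventually (\<lambda>n. lam n > x) sequentially"
      using dat by (auto simp: dirichlet_data_def filterlim_at_top_dense)
    then obtain N where "\<And>n. n \<ge> N \<Longrightarrow> lam n > x" by (auto simp: eventually_sequentially)
    hence "{n. lam n \<le> x} \<subseteq> {..<N}" by (auto simp: not_le[symmetric])
    thus ?thesis by (rule finite_subset) auto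
  qed
  moreover have "(\<Sum>n | lam n \<le> x. a n) \<le> W" if "h > 0"
  proof -
    have "(\<Sum>n | lam n \<le> x. a n) = (\<Sum>n | lam n \<le> x. a n * w n)"
      using w(5)[OF that] x by (intro sum.cong) (auto simp: u_def)
    also have "\<dots> \<le> W" unfolding W_def using w(3) by (intro sum_le_suminf sw fin) auto
    finally show ?thesis .
  qed
  moreover have "W \<le> (\<Sum>n | lam n \<le> x. a n)" if "h < 0"
  proof -
    have "W = (\<Sum>n | lam n \<le> x. a n * w n)"
      unfolding W_def using w(6)[OF that] x by (intro suminf_finite fin) (auto simp: u_def)
    also have "\<dots> \<le> (\<Sum>n | lam n \<le> x. a n)" using w(3,4) by (intro sum_mono) (auto intro: mult_left_le)
    finally show ?thesis .
  qed
  ultimately show ?thesis using that[of W] by (simp add: c_def)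
qed

text \<open>\<open>c0\<close> makes |s| \<ge> c0 (1 + |t|) on the line, and \<open>U\<close> is the
  height, kept at least 1, beyond which the kernel decays. The factor 1 / s lowers the exponent
  \<kappa> to \<kappa> - 1, which matches the profile with P = U^\<kappa>.\<close>

lemma left_line_bound:
  fixes \<alpha> \<delta> \<kappa> C x h :: real
  assumes B: "hypothesis_B \<alpha> \<delta> \<kappa> m C a lam A" and \<delta>: "0 < \<delta>" "\<delta> < \<alpha>" and h: "h \<noteq> 0" "\<bar>h\<bar> \<le> 1"
    and x: "x > 0" and \<kappa>: "\<kappa> > 0" and C: "C \<ge> 1" and k: "real k \<ge> real (m - 1) + 2 * \<kappa>"
  defines "c0 \<equiv> min 1 (\<alpha> - \<delta>) / 2" and "U \<equiv> 1 + 1 / \<bar>h\<bar>"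
  defines "Q \<equiv> C * x powr (\<alpha> - \<delta>) / c0 * (2 * exp (\<alpha> - \<delta>) / c0) ^ k * (4 * (2 * ln (2 + U)) ^ (m - 1))"
  shows "integrable lborel (\<lambda>t. smoothed_integrand A x h k (Complex (\<alpha> - \<delta>) t))" (is "integrable _ ?f")
    and "norm (LINT t|lborel. smoothed_integrand A x h k (Complex (\<alpha> - \<delta>) t)) \<le> Q * (2 * U powr \<kappa> / \<kappa>)"
proof -
  define \<sigma> where "\<sigma> = \<alpha> - \<delta>"
  have \<sigma>: "\<sigma> > 0" "\<sigma> < \<alpha>" using \<delta> by (auto simp: \<sigma>_def)
  have c0: "c0 > 0" "c0 \<le> 1 / 2" using \<delta> by (auto simp: c0_def)
  have U: "U \<ge> 1" "1 / \<bar>h\<bar> \<le> U" by (auto simp: U_def)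
  have lnU: "ln (2 + U) \<ge> 0" using U by simp
  define \<phi> where "\<phi> = (\<lambda>t. (1 + \<bar>t\<bar>) powr (\<kappa> - 1) / (1 + (1 + \<bar>t\<bar>) powr \<kappa> / U powr \<kappa>)\<^sup>2)"
  have Q0: "Q \<ge> 0" using C c0 lnU by (simp add: Q_def)
  have bound: "norm (?f t) \<le> Q * \<phi> t" for t
  proof -
    define s u r where "s = Complex \<sigma> t" and "u = 1 + \<bar>t\<bar>" and "r = min 1 (U / u)"
    have u: "u \<ge> 1" by (simp add: u_def)
    have s: "s \<noteq> 0" using \<sigma> by (auto simp: s_def complex_eq_iff)
    have r: "r \<ge> 0" using U u by (simp add: r_def)
    have "norm s \<ge> \<sigma>" "norm s \<ge> \<bar>t\<bar>"
      using complex_Re_le_cmod[of s] abs_Im_le_cmod[of s] by (auto simp: s_def)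
    moreover have "c0 \<le> \<sigma> / 2" by (simp add: c0_def \<sigma>_def)
    moreover have "c0 * \<bar>t\<bar> \<le> 1 / 2 * \<bar>t\<bar>" using c0 by (intro mult_right_mono) auto
    ultimately have su: "norm s \<ge> c0 * u" unfolding u_def distrib_left by linarith
    have A: "norm (A s) \<le> C * u powr \<kappa> * ln (2 + u) ^ (m - 1)"
    proof -
      have "Re s = \<alpha> - \<delta>" by (simp add: s_def \<sigma>_def)
      hence "norm (A s) \<le> C * (1 + \<bar>Im s\<bar>) powr \<kappa> * ln (3 + \<bar>Im s\<bar>) ^ (m - 1)"
        using B unfolding hypothesis_B_def by blast
      also have "3 + \<bar>Im s\<bar> = 2 + u" by (simp add: s_def u_def)
      finally show ?thesis by (simp add: s_def u_def)
    qed
    have E: "norm (exp (of_real (ln x) * s)) = x powr \<sigma>"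
      using x by (simp add: powr_def s_def mult.commute)
    have box: "norm (boxker h s) \<le> 2 * exp \<sigma> / c0 * r"
    proof (cases "U / u \<ge> 1")
      case True
      have "norm (boxker h s) \<le> exp (\<bar>h\<bar> * \<bar>Re s\<bar>)" by (rule norm_boxker_le(1)[OF h(1) s])
      also have "\<dots> \<le> exp (1 * \<sigma>)"
        using h \<sigma> by (subst exp_le_cancel_iff, intro mult_mono) (auto simp: s_def)
      also have "\<dots> \<le> 2 * exp \<sigma> / c0" using c0 by (simp add: field_simps)
      finally show ?thesis using True by (simp add: r_def)
    next
      case False
      have "norm (boxker h s) \<le> 2 * exp (\<bar>h\<bar> * \<bar>Re s\<bar>) / (\<bar>h\<bar> * norm s)" by (rule norm_boxker_le(2)[OF h(1) s])
      also have "\<dots> \<le> 2 * exp (1 * \<sigma>) / (\<bar>h\<bar> * (c0 * u))"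
      proof (rule frac_le)
        show "2 * exp (\<bar>h\<bar> * \<bar>Re s\<bar>) \<le> 2 * exp (1 * \<sigma>)"
          using h \<sigma> by (intro mult_left_mono, subst exp_le_cancel_iff, intro mult_mono) (auto simp: s_def)
      qed (use h c0 u su in auto)
      also have "\<dots> = 2 * exp \<sigma> / c0 * ((1 / \<bar>h\<bar>) / u)" by simp
      also have "\<dots> \<le> 2 * exp \<sigma> / c0 * (U / u)"
        using c0 U u by (intro mult_left_mono divide_right_mono) auto
      finally show ?thesis using False by (simp add: r_def)
    qed
    have "norm (?f t) = norm (A s) * (x powr \<sigma> / norm s * norm (boxker h s) ^ k)"
      using E by (simp add: smoothed_integrand_def norm_mult norm_divide norm_power s_def \<sigma>_def)
    also have "\<dots> \<le> (C * u powr \<kappa> * ln (2 + u) ^ (m - 1)) * (x powr \<sigma> / (c0 * u) * (2 * exp \<sigma> / c0 * r) ^ k)"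
      using A su box u c0 C r s by (intro mult_mono divide_left_mono power_mono) auto
    also have "\<dots> = C * x powr \<sigma> / c0 * (2 * exp \<sigma> / c0) ^ k * (u powr \<kappa> / u) * (ln (2 + u) ^ (m - 1) * r ^ k)"
      unfolding power_mult_distrib[of _ r] by simp
    also have "u powr \<kappa> / u = u powr (\<kappa> - 1)" using u by (simp add: powr_diff)
    also have "C * x powr \<sigma> / c0 * (2 * exp \<sigma> / c0) ^ k * u powr (\<kappa> - 1) * (ln (2 + u) ^ (m - 1) * r ^ k)
      \<le> C * x powr \<sigma> / c0 * (2 * exp \<sigma> / c0) ^ k * u powr (\<kappa> - 1) *
        ((2 * ln (2 + U)) ^ (m - 1) * (4 / (1 + u powr \<kappa> / U powr \<kappa>)\<^sup>2))"
      unfolding r_def using u U \<kappa> k C c0 by (intro mult_left_mono log_power_cutoff_le) auto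
    also have "\<dots> = Q * \<phi> t" by (simp add: Q_def \<phi>_def u_def \<sigma>_def)
    finally show ?thesis .
  qed
  have int: "integrable lborel (\<lambda>t. Q * \<phi> t)" "(LINT t|lborel. Q * \<phi> t) \<le> Q * (2 * U powr \<kappa> / \<kappa>)"
  proof -
    have "integrable lborel \<phi>" and le: "(LINT t|lborel. \<phi> t) \<le> 2 * U powr \<kappa> / \<kappa>"
      using kernel_profile_integral[of \<kappa> "U powr \<kappa>"] \<kappa> U unfolding \<phi>_def by auto
    thus "integrable lborel (\<lambda>t. Q * \<phi> t)" by simp
    have "(LINT t|lborel. Q * \<phi> t) = Q * (LINT t|lborel. \<phi> t)" by simp
    also have "\<dots> \<le> Q * (2 * U powr \<kappa> / \<kappa>)" using le Q0 by (intro mult_left_mono) auto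
    finally show "(LINT t|lborel. Q * \<phi> t) \<le> Q * (2 * U powr \<kappa> / \<kappa>)" .
  qed
  obtain S where S: "{s. Re s \<ge> \<alpha> - \<delta>} \<subseteq> S" "smoothed_integrand A x h k holomorphic_on S - {of_real \<alpha>}"
    using hypothesis_B_holomorphic[OF B \<delta> h(1)] by metis
  have "continuous_on {s. Re s = \<alpha> - \<delta>} (smoothed_integrand A x h k)"
    using S \<sigma> \<delta> by (intro holomorphic_on_imp_continuous_on holomorphic_on_subset[OF S(2)]) auto
  from continuous_on_vertical_line[OF this, of UNIV]
  have meas: "?f \<in> borel_measurable lborel" by (simp add: borel_measurable_continuous_onI)
  show int': "integrable lborel ?f"
    by (rule Bochner_Integration.integrable_bound[OF int(1) meas])
       (use bound in \<open>auto intro!: always_eventually order_trans[OF _ abs_ge_self]\<close>)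
  show "norm (LINT t|lborel. ?f t) \<le> Q * (2 * U powr \<kappa> / \<kappa>)"
    using bound int(2)
    by (intro order_trans[OF Bochner_Integration.integral_norm_bound_integral[OF int' int(1)] int(2)]) auto
qed

text \<open>The kernel contributes |s|^(-k) against a growth of at most |s|^N, and the remaining 1 /
  s makes the horizontal edges vanish. As h and x are fixed here, the size of the constant
  \<open>E\<close> is immaterial.\<close>

lemma smoothed_contour_shift:
  fixes \<alpha> \<delta> \<kappa> C x h D :: real
  assumes B: "hypothesis_B \<alpha> \<delta> \<kappa> m C a lam A" and \<delta>: "0 < \<delta>" "\<delta> < \<alpha>" and h: "h \<noteq> 0"
    and x: "x > 0" and D: "D > 0"
      "\<And>s. \<alpha> - \<delta> \<le> Re s \<Longrightarrow> Re s \<le> \<alpha> + \<delta> \<Longrightarrow> norm ((s - of_real \<alpha>) ^ m * A s) \<le> D * norm s ^ N"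
    and k: "k \<ge> N"
    and int: "integrable lborel (\<lambda>t. smoothed_integrand A x h k (Complex (\<alpha> - \<delta>) t))"
      "integrable lborel (\<lambda>t. smoothed_integrand A x h k (Complex (\<alpha> + \<delta>) t))"
  shows "(LINT t|lborel. smoothed_integrand A x h k (Complex (\<alpha> + \<delta>) t))
       - (LINT t|lborel. smoothed_integrand A x h k (Complex (\<alpha> - \<delta>) t))
       = 2 * pi * residue (smoothed_integrand A x h k) (of_real \<alpha>)"
proof -
  obtain S where S: "open S" "{s. Re s \<ge> \<alpha> - \<delta>} \<subseteq> S" "smoothed_integrand A x h k holomorphic_on S - {of_real \<alpha>}"
    using hypothesis_B_holomorphic[OF B \<delta> h] by metis
  define b where "b = \<alpha> + \<delta>"
  define E where "E = D * exp (\<bar>ln x\<bar> * b) * (2 * exp (\<bar>h\<bar> * b) / \<bar>h\<bar>) ^ k"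
  show ?thesis
  proof (rule vertical_line_shift[OF S(1,3), where ?T0.0 = 1 and g = "\<lambda>t. E / t"])
    show "((\<lambda>t. E / t) \<longlongrightarrow> 0) at_top" by real_asymp
    fix s assume s: "\<alpha> - \<delta> \<le> Re s" "Re s \<le> \<alpha> + \<delta>" "1 < \<bar>Im s\<bar>"
    have ns: "norm s \<ge> \<bar>Im s\<bar>" "norm (s - of_real \<alpha>) \<ge> 1" "norm s \<ge> 1"
      using abs_Im_le_cmod[of s] abs_Im_le_cmod[of "s - of_real \<alpha>"] s by auto
    have nz: "s \<noteq> 0" using ns by auto
    have "norm (A s) \<le> norm (s - of_real \<alpha>) ^ m * norm (A s)"
      using ns mult_right_mono[of 1 "norm (s - of_real \<alpha>) ^ m" "norm (A s)"] by simp
    also have "\<dots> \<le> D * norm s ^ N" using D(2)[of s] s by (simp add: norm_mult norm_power)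
    also have "\<dots> \<le> D * norm s ^ k" using D(1) k ns by (intro mult_left_mono power_increasing) auto
    finally have A: "norm (A s) \<le> D * norm s ^ k" .
    have "ln x * Re s \<le> \<bar>ln x\<bar> * \<bar>Re s\<bar>" by (simp flip: abs_mult)
    also have "\<dots> \<le> \<bar>ln x\<bar> * b" using s \<delta> by (intro mult_left_mono) (auto simp: b_def)
    finally have ex: "norm (exp (of_real (ln x) * s)) \<le> exp (\<bar>ln x\<bar> * b)" by simp
    have "norm (boxker h s) \<le> 2 * exp (\<bar>h\<bar> * \<bar>Re s\<bar>) / (\<bar>h\<bar> * norm s)" by (rule norm_boxker_le(2)[OF h nz])
    also have "\<dots> \<le> 2 * exp (\<bar>h\<bar> * b) / (\<bar>h\<bar> * norm s)"
      using s \<delta> by (intro divide_right_mono mult_left_mono) (auto simp: b_def intro!: mult_left_mono)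
    finally have box: "norm (boxker h s) \<le> 2 * exp (\<bar>h\<bar> * b) / \<bar>h\<bar> / norm s" by simp
    have "norm (smoothed_integrand A x h k s) =
        norm (A s) * (norm (exp (of_real (ln x) * s)) / norm s * norm (boxker h s) ^ k)"
      by (simp add: smoothed_integrand_def norm_mult norm_divide norm_power)
    also have "\<dots> \<le> D * norm s ^ k * (exp (\<bar>ln x\<bar> * b) / norm s * (2 * exp (\<bar>h\<bar> * b) / \<bar>h\<bar> / norm s) ^ k)"
      using A ex box D(1) by (intro mult_mono divide_right_mono power_mono) auto
    also have "\<dots> = E / norm s" using nz unfolding E_def power_divide[of _ "norm s"] by simp
    also have "\<dots> \<le> E / \<bar>Im s\<bar>"
      using ns s D(1) by (intro divide_left_mono mult_pos_pos) (auto simp: E_def)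
    finally show "norm (smoothed_integrand A x h k s) \<le> E / \<bar>Im s\<bar>" .
  qed (use S int \<delta> in auto)
qed

text \<open>Both residues are integrals over one circle, on which \<open>boxker h s ^ k - 1\<close>
  is O(|h|).\<close>

lemma residue_smoothing_error:
  fixes \<alpha> \<delta> \<kappa> C x h D :: real
  assumes B: "hypothesis_B \<alpha> \<delta> \<kappa> m C a lam A" and \<delta>: "0 < \<delta>" "\<delta> < \<alpha>" and h: "h \<noteq> 0" "\<bar>h\<bar> \<le> 1"
    and x: "x \<ge> 2" and m: "m \<ge> 1" and D: "D > 0"
      "\<And>s. \<alpha> - \<delta> \<le> Re s \<Longrightarrow> Re s \<le> \<alpha> + \<delta> \<Longrightarrow> norm ((s - of_real \<alpha>) ^ m * A s) \<le> D * norm s ^ N"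
  shows "norm (residue (smoothed_integrand A x h k) (of_real \<alpha>)
             - residue (\<lambda>s. A s * (of_real x powr s / s)) (of_real \<alpha>))
         \<le> D * (2 * \<alpha>) ^ N * exp (\<delta> / 4) * (k * exp (2 * \<alpha>) ^ k * exp (2 * \<alpha>)) * (4 / \<delta>) ^ (m - 1)
           * (\<bar>h\<bar> * x powr \<alpha> * ln x ^ (m - 1))"
proof -
  let ?\<alpha> = "complex_of_real \<alpha>"
  define f0 where "f0 = (\<lambda>s. A s * (of_real x powr s / s))"
  define f where "f = smoothed_integrand A x h k"
  have lnx: "ln x \<ge> 1 / 2"
  proof -
    have "ln x \<ge> ln 2" using x by simp
    thus ?thesis using ln2_ge_two_thirds by simp
  qed
  \<comment> \<open>Proportional to 1 / ln x so that |x^s| exceeds x^\<alpha> by at most exp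
    (\<delta> / 4). The 4 gives \<rho> \<le> \<delta> / 2, as ln x \<ge> 1/2, so the circle lies
    well inside the strip.\<close>
  define \<rho> where "\<rho> = \<delta> / (4 * ln x)"
  have \<rho>: "\<rho> > 0" using lnx \<delta> by (simp add: \<rho>_def)
  have \<rho>2: "\<rho> \<le> \<delta> / 2" using lnx \<delta> by (simp add: \<rho>_def field_simps)
  obtain S where S: "open S" "{s. Re s \<ge> \<alpha> - \<delta>} \<subseteq> S" "0 \<notin> S" "A holomorphic_on S - {?\<alpha>}" "f holomorphic_on S - {?\<alpha>}"
    using hypothesis_B_holomorphic[OF B \<delta> h(1)] unfolding f_def by metis
  have ex: "of_real x powr s = exp (of_real (ln x) * s)" for s :: complex
    using x by (simp add: powr_def Ln_of_real mult.commute)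
  have f0: "f0 holomorphic_on S - {?\<alpha>}"
    unfolding f0_def ex using S(3,4) by (intro holomorphic_intros) auto
  have Re_near: "\<bar>Re s - \<alpha>\<bar> \<le> \<rho>" if "norm (s - ?\<alpha>) \<le> \<rho>" for s
    using abs_Re_le_cmod[of "s - ?\<alpha>"] that by simp
  have sub: "cball ?\<alpha> \<rho> \<subseteq> S"
  proof
    fix s assume "s \<in> cball ?\<alpha> \<rho>"
    hence "norm (s - ?\<alpha>) \<le> \<rho>" by (simp add: dist_norm norm_minus_commute)
    with Re_near[OF this] show "s \<in> S" using S(2) \<rho>2 \<delta> by auto
  qed
  have \<alpha>S: "?\<alpha> \<in> S" using sub \<rho> by auto
  define R where "R = exp (2 * \<alpha>)"
  define M where "M = D * (2 * \<alpha>) ^ N / \<rho> ^ m * (x powr \<alpha> * exp (\<delta> / 4)) * (k * R ^ k * (R * \<bar>h\<bar>))"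
  have M0: "M \<ge> 0" using D(1) \<delta> \<rho> by (simp add: M_def R_def)
  have "((\<lambda>s. f s - f0 s) has_contour_integral (2 * pi * \<i> * residue f ?\<alpha> - 2 * pi * \<i> * residue f0 ?\<alpha>)) (circlepath ?\<alpha> \<rho>)"
    by (intro has_contour_integral_diff base_residue[OF S(1) \<alpha>S \<rho>] S f0 sub)
  hence "norm (2 * pi * \<i> * residue f ?\<alpha> - 2 * pi * \<i> * residue f0 ?\<alpha>) \<le> M * (2 * pi * \<rho>)"
  proof (rule has_contour_integral_bound_circlepath[OF _ M0 \<rho>])
    fix s assume s: "norm (s - ?\<alpha>) = \<rho>"
    have Re: "\<bar>Re s - \<alpha>\<bar> \<le> \<rho>" using Re_near s by simp
    have nz: "s \<noteq> 0" using Re \<rho>2 \<delta> by auto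
    have ns: "norm s \<le> 2 * \<alpha>"
      using norm_triangle_ineq[of "s - ?\<alpha>" ?\<alpha>] s \<rho>2 \<delta> by simp
    have "\<rho> ^ m * norm (A s) \<le> D * norm s ^ N"
      using D(2)[of s] Re \<rho>2 \<delta> s by (simp add: norm_mult norm_power)
    also have "\<dots> \<le> D * (2 * \<alpha>) ^ N" using D(1) ns by (intro mult_left_mono power_mono) auto
    finally have A: "norm (A s) \<le> D * (2 * \<alpha>) ^ N / \<rho> ^ m" using \<rho> by (simp add: field_simps)
    have "ln x * Re s \<le> ln x * (\<alpha> + \<rho>)" using Re lnx by (intro mult_left_mono) auto
    also have "\<dots> = \<alpha> * ln x + \<delta> / 4" using lnx by (simp add: \<rho>_def field_simps)
    finally have E: "norm (exp (of_real (ln x) * s)) \<le> x powr \<alpha> * exp (\<delta> / 4)"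
      using x by (simp add: powr_def flip: exp_add)
    have hs: "\<bar>h\<bar> * norm s \<le> 1 * (2 * \<alpha>)" using h ns by (intro mult_mono) auto
    have "norm (boxker h s) \<le> exp (\<bar>h\<bar> * \<bar>Re s\<bar>)" by (rule norm_boxker_le(1)[OF h(1) nz])
    also have "\<dots> \<le> R"
      unfolding R_def using hs order_trans[OF mult_left_mono[OF abs_Re_le_cmod[of s], of "\<bar>h\<bar>"], of "2 * \<alpha>"] by simp
    finally have "norm (boxker h s ^ k - 1) \<le> k * R ^ k * norm (boxker h s - 1)"
      using \<delta> by (intro norm_power_minus_1_le) (auto simp: R_def)
    also have "\<dots> \<le> k * R ^ k * (exp (\<bar>h\<bar> * norm s) * (\<bar>h\<bar> * norm s))"
      by (intro mult_left_mono norm_boxker_le(3)[OF h(1) nz]) (auto simp: R_def)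
    also have "\<dots> \<le> k * R ^ k * (R * (\<bar>h\<bar> * norm s))"
      using hs by (intro mult_left_mono mult_right_mono) (auto simp: R_def)
    finally have box: "norm ((boxker h s ^ k - 1) / s) \<le> k * R ^ k * (R * \<bar>h\<bar>)"
      using nz by (simp add: norm_divide divide_le_eq mult_ac)
    have "f s - f0 s = A s * exp (of_real (ln x) * s) * ((boxker h s ^ k - 1) / s)"
      by (simp add: f_def f0_def smoothed_integrand_def ex algebra_simps diff_divide_distrib)
    hence "norm (f s - f0 s) = norm (A s) * norm (exp (of_real (ln x) * s)) * norm ((boxker h s ^ k - 1) / s)"
      by (simp only: norm_mult)
    also have "\<dots> \<le> M"
      unfolding M_def using A E box D(1) \<delta> \<rho> by (intro mult_mono) (auto intro!: mult_nonneg_nonneg)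
    finally show "norm (f s - f0 s) \<le> M" .
  qed
  also have "2 * pi * \<i> * residue f ?\<alpha> - 2 * pi * \<i> * residue f0 ?\<alpha> = (2 * pi * \<i>) * (residue f ?\<alpha> - residue f0 ?\<alpha>)"
    by (simp add: algebra_simps)
  finally have "norm (residue f ?\<alpha> - residue f0 ?\<alpha>) \<le> M * \<rho>"
    by (simp add: norm_mult)
  also have "\<rho> ^ m = \<rho> ^ (m - 1) * \<rho>" using m by (cases m) auto
  hence "M * \<rho> = D * (2 * \<alpha>) ^ N * (1 / \<rho> ^ (m - 1)) * (x powr \<alpha> * exp (\<delta> / 4)) * (k * R ^ k * (R * \<bar>h\<bar>))"
    using \<rho> by (simp add: M_def)
  also have "1 / \<rho> ^ (m - 1) = (4 / \<delta>) ^ (m - 1) * ln x ^ (m - 1)"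
    by (simp add: \<rho>_def power_divide power_mult_distrib)
  finally show ?thesis by (simp add: f_def f0_def R_def mult_ac)
qed

section \<open>Choice of parameters and conclusion\<close>

theorem theoremB:
  fixes \<alpha> \<delta> \<kappa> C :: real and m :: nat and v :: complex
  assumes "\<alpha> > 0" and "0 < \<delta>" and "\<delta> < \<alpha>" and "\<kappa> > 0" and "m \<ge> 1" and "C \<ge> 1"
  shows "\<exists>K::real. \<forall>(a :: nat \<Rightarrow> real) (lam :: nat \<Rightarrow> real) (A :: complex \<Rightarrow> complex).
           hypothesis_B \<alpha> \<delta> \<kappa> m C a lam A \<and> A (complex_of_real (\<alpha> + \<delta>)) = v \<longrightarrow>
           (\<forall>x::real. x \<ge> 2 \<longrightarrow>
              norm (complex_of_real (\<Sum>n | lam n \<le> x. a n)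
                    - residue (\<lambda>s. A s * (complex_of_real x powr s / s)) (complex_of_real \<alpha>))
              \<le> K * (x powr (\<alpha> - \<delta> / (\<kappa> + 1)) * ln x ^ (m - 1)))"
proof -
  \<comment> \<open>Large enough for both demands: k \<ge> \<kappa> + 2m lets k itself be the degree
    N of the strip bound, and k \<ge> m - 1 + 2 \<kappa> is what the left line requires.\<close>
  define k where "k = nat \<lceil>2 * \<kappa>\<rceil> + 2 * m"
  have k: "k \<ge> 1" "real k \<ge> \<kappa> + 2 * real m" "real k \<ge> real (m - 1) + 2 * \<kappa>"
  proof -
    have "real (nat \<lceil>2 * \<kappa>\<rceil>) \<ge> 2 * \<kappa>" by (rule of_nat_ceiling)
    moreover have "real (m - 1) \<le> 2 * real m" by linarith
    ultimately show "real k \<ge> \<kappa> + 2 * real m" "real k \<ge> real (m - 1) + 2 * \<kappa>"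
      using \<open>\<kappa> > 0\<close> unfolding k_def of_nat_add of_nat_mult of_nat_numeral by linarith+
    show "k \<ge> 1" using \<open>m \<ge> 1\<close> by (simp add: k_def)
  qed
  obtain D where D: "D > 0"
    "\<And>a lam A s. hypothesis_B \<alpha> \<delta> \<kappa> m C a lam A \<Longrightarrow> A (of_real (\<alpha> + \<delta>)) = v \<Longrightarrow>
       \<alpha> - \<delta> \<le> Re s \<Longrightarrow> Re s \<le> \<alpha> + \<delta> \<Longrightarrow> norm ((s - of_real \<alpha>) ^ m * A s) \<le> D * norm s ^ k"
    using hypothesis_B_strip_bound[OF assms(2-6) k(2), of v] by blast
  define \<eta> where "\<eta> = \<delta> / (\<kappa> + 1)"
  have \<eta>: "\<eta> > 0" "\<alpha> - \<delta> + \<eta> * \<kappa> = \<alpha> - \<eta>"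
    using assms by (auto simp: \<eta>_def field_simps)
  define c0 where "c0 = min 1 (\<alpha> - \<delta>) / 2"
  have c0: "c0 > 0" using assms by (auto simp: c0_def)
  define K0 where "K0 = C / c0 * (2 * exp (\<alpha> - \<delta>) / c0) ^ k"
  have K0: "K0 \<ge> 0" using assms c0 by (simp add: K0_def)
  define K1 where "K1 = K0 * (4 * (2 * (2 + \<eta>)) ^ (m - 1)) * (2 * 2 powr \<kappa> / \<kappa>)"
  define K2 where "K2 = D * (2 * \<alpha>) ^ k * exp (\<delta> / 4) * (k * exp (2 * \<alpha>) ^ k * exp (2 * \<alpha>)) * (4 / \<delta>) ^ (m - 1)"
  have main: "norm (complex_of_real (\<Sum>n | lam n \<le> x. a n)
                    - residue (\<lambda>s. A s * (complex_of_real x powr s / s)) (complex_of_real \<alpha>))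
              \<le> 3 * (K1 + K2) * (x powr (\<alpha> - \<delta> / (\<kappa> + 1)) * ln x ^ (m - 1))"
    if B: "hypothesis_B \<alpha> \<delta> \<kappa> m C a lam A" and v: "A (complex_of_real (\<alpha> + \<delta>)) = v" and x: "x \<ge> 2"
    for a lam A x
  proof -
    define X where "X = x powr (\<alpha> - \<eta>) * ln x ^ (m - 1)"
    define r0 where "r0 = residue (\<lambda>s. A s * (complex_of_real x powr s / s)) (complex_of_real \<alpha>)"
    define S where "S = (\<Sum>n | lam n \<le> x. a n)"
    have x0: "x > 0" using x by simp
    have *: "\<exists>W. norm (complex_of_real W - r0) \<le> (K1 + K2) * X \<and> (h > 0 \<longrightarrow> S \<le> W) \<and> (h < 0 \<longrightarrow> W \<le> S)"
      if habs: "\<bar>h\<bar> = x powr (- \<eta>)" for h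
    proof -
      have h: "h \<noteq> 0" "\<bar>h\<bar> \<le> 1"
        using habs x \<eta> by (auto simp: powr_le_one_le) (simp add: powr_minus field_simps ge_one_powr_ge_zero)
      define f where "f = smoothed_integrand A x h k"
      obtain W :: real where W: "integrable lborel (\<lambda>t. f (Complex (\<alpha> + \<delta>) t))"
        "(LINT t|lborel. f (Complex (\<alpha> + \<delta>) t)) = 2 * pi * W" "h > 0 \<Longrightarrow> S \<le> W" "h < 0 \<Longrightarrow> W \<le> S"
        using smoothed_sum_sandwich[OF B assms(2,3) h(1) k(1) x0] unfolding S_def f_def by blast
      define U where "U = 1 + 1 / \<bar>h\<bar>"
      define I where "I = (LINT t|lborel. f (Complex (\<alpha> - \<delta>) t))"
      have left: "integrable lborel (\<lambda>t. f (Complex (\<alpha> - \<delta>) t))"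
        "norm I \<le> C * x powr (\<alpha> - \<delta>) / c0 * (2 * exp (\<alpha> - \<delta>) / c0) ^ k * (4 * (2 * ln (2 + U)) ^ (m - 1)) * (2 * U powr \<kappa> / \<kappa>)"
        using left_line_bound[OF B assms(2,3) h x0 assms(4,6) k(3)] unfolding f_def c0_def U_def I_def by auto
      have shift: "2 * pi * W - I = 2 * pi * residue f (of_real \<alpha>)"
        using smoothed_contour_shift[OF B assms(2,3) h(1) x0 D(1) D(2)[OF B v] order_refl] left(1) W(1,2)
        unfolding f_def I_def by auto
      have xe: "x powr \<eta> \<ge> 1" using x \<eta> by (intro ge_one_powr_ge_zero) auto
      have Ux: "U = 1 + x powr \<eta>" by (simp add: U_def habs powr_minus divide_inverse)
      have lnx: "ln x > 0" using x by simp
      have "U powr \<kappa> \<le> (2 * x powr \<eta>) powr \<kappa>"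
        using Ux xe assms by (intro powr_mono2) auto
      also have "\<dots> = 2 powr \<kappa> * x powr (\<eta> * \<kappa>)" using x by (simp add: powr_mult powr_powr)
      finally have U1: "U powr \<kappa> \<le> 2 powr \<kappa> * x powr (\<eta> * \<kappa>)" .
      \<comment> \<open>2 + U = 3 + x^\<eta> \<le> 4 x^\<eta>; then ln 2 \<le> ln x turns the
        additive constant into a multiple of ln x.\<close>
      have "ln (2 + U) \<le> ln (2 ^ 2 * x powr \<eta>)" using Ux xe by (subst ln_le_cancel_iff) auto
      also have "\<dots> = 2 * ln 2 + \<eta> * ln x" using x ln_realpow[of "2::real" 2] by (simp add: ln_mult ln_powr)
      also have "\<dots> \<le> (2 + \<eta>) * ln x" using x by (simp add: algebra_simps)
      finally have U2: "2 * ln (2 + U) \<le> 2 * (2 + \<eta>) * ln x" unfolding mult.assoc by linarith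
      have U3: "ln (2 + U) \<ge> 0" using Ux xe by simp
      have pw: "(2 * ln (2 + U)) ^ (m - 1) \<le> (2 * (2 + \<eta>) * ln x) ^ (m - 1)"
        using U2 U3 by (intro power_mono) auto
      have "norm I \<le> C * x powr (\<alpha> - \<delta>) / c0 * (2 * exp (\<alpha> - \<delta>) / c0) ^ k * (4 * (2 * ln (2 + U)) ^ (m - 1)) * (2 * U powr \<kappa> / \<kappa>)"
        by (rule left(2))
      also have "\<dots> = K0 * x powr (\<alpha> - \<delta>) * (4 * (2 * ln (2 + U)) ^ (m - 1)) * (2 * U powr \<kappa> / \<kappa>)"
        by (simp add: K0_def)
      also have "\<dots> \<le> K0 * x powr (\<alpha> - \<delta>) * (4 * (2 * (2 + \<eta>) * ln x) ^ (m - 1)) * (2 * (2 powr \<kappa> * x powr (\<eta> * \<kappa>)) / \<kappa>)"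
        using U1 U3 K0 assms lnx \<eta>(1) by (intro mult_mono mult_left_mono pw divide_right_mono) auto
      also have "\<dots> = K1 * (x powr (\<alpha> - \<delta>) * x powr (\<eta> * \<kappa>) * ln x ^ (m - 1))"
        unfolding K1_def power_mult_distrib[of _ "ln x"] by simp
      also have "x powr (\<alpha> - \<delta>) * x powr (\<eta> * \<kappa>) = x powr (\<alpha> - \<eta>)"
        unfolding \<eta>(2)[symmetric] powr_add ..
      finally have I: "norm I \<le> K1 * X" by (simp add: X_def)
      have "norm (complex_of_real W - residue f (of_real \<alpha>)) \<le> norm I"
      proof -
        have "I = complex_of_real (2 * pi) * (complex_of_real W - residue f (of_real \<alpha>))"
          using shift by (simp add: algebra_simps)
        hence "norm I = 2 * pi * norm (complex_of_real W - residue f (of_real \<alpha>))"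
          by (simp add: norm_mult)
        moreover have "1 * norm (complex_of_real W - residue f (of_real \<alpha>)) \<le> 2 * pi * norm (complex_of_real W - residue f (of_real \<alpha>))"
          using pi_gt3 by (intro mult_right_mono) auto
        ultimately show ?thesis by simp
      qed
      moreover have "norm (residue f (of_real \<alpha>) - r0) \<le> K2 * (\<bar>h\<bar> * x powr \<alpha> * ln x ^ (m - 1))"
        unfolding K2_def f_def r0_def
        by (rule residue_smoothing_error[OF B assms(2,3) h x assms(5) D(1) D(2)[OF B v]])
      moreover have "\<bar>h\<bar> * x powr \<alpha> * ln x ^ (m - 1) = X"
        by (simp add: X_def habs flip: powr_add)
      moreover have "norm (complex_of_real W - r0) \<le>
          norm (complex_of_real W - residue f (of_real \<alpha>)) + norm (residue f (of_real \<alpha>) - r0)"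
        using norm_triangle_ineq[of "complex_of_real W - residue f (of_real \<alpha>)" "residue f (of_real \<alpha>) - r0"] by simp
      ultimately have "norm (complex_of_real W - r0) \<le> (K1 + K2) * X"
        using I by (simp add: distrib_right)
      thus ?thesis using W(3,4) by blast
    qed
    have xp: "x powr (- \<eta>) > 0" using x by simp
    obtain W1 where W1: "norm (complex_of_real W1 - r0) \<le> (K1 + K2) * X" "S \<le> W1"
      using *[of "x powr (- \<eta>)"] xp by auto
    obtain W2 where W2: "norm (complex_of_real W2 - r0) \<le> (K1 + K2) * X" "W2 \<le> S"
      using *[of "- (x powr (- \<eta>))"] xp by auto
    \<comment> \<open>The residue \<open>r0\<close> is not known to be real, so the sandwich is
      applied to the real numbers W2 \<le> S \<le> W1. Two errors bound W1 - W2 and a third returns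
      from W2 to \<open>r0\<close>, whence the factor 3.\<close>
    have "norm (complex_of_real S - complex_of_real W2) \<le> norm (complex_of_real W1 - complex_of_real W2)"
      using W1(2) W2(2) by (simp flip: of_real_diff)
    also have "\<dots> \<le> norm (complex_of_real W1 - r0) + norm (complex_of_real W2 - r0)"
      using norm_triangle_ineq4[of "complex_of_real W1 - r0" "complex_of_real W2 - r0"] by simp
    finally have "norm (complex_of_real S - r0) \<le> 3 * ((K1 + K2) * X)"
      using W1(1) W2(1) norm_triangle_ineq[of "complex_of_real S - complex_of_real W2" "complex_of_real W2 - r0"] by simp
    thus ?thesis unfolding S_def r0_def X_def \<eta>_def by (simp only: mult.assoc)
  qed
  show ?thesis using main by (intro exI[of _ "3 * (K1 + K2)"]) blast
qed

end
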